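(* Assume that the sequence $\mathbf{P}(n\in\tau)$ is regularly varying and that the sequence $U_n:=\sum_{k=0}^n\mathbf{P}(k\in\tau)$ is slowly varying. Then there exists a sequence of positive numbers $\epsilon_n\to0$ such that $$\frac{1}{\epsilon_n n}\sum_{(1-\epsilon_n)n<k\le n}\mathbf{P}(\tau_1=k)\sim\mathbf{P}(\tau_1>n)^2\,\mathbf{P}(n\in\tau)\qquad\text{as } n\to\infty.$$ If also the sequence $\mathbf{P}(\tau_1=n)$ is regularly varying, then $$\mathbf{P}(\tau_1=n)\sim\mathbf{P}(\tau_1>n)^2\,\mathbf{P}(n\in\tau)\qquad\text{as } n\to\infty.$$
   Context: $\tau=\{0=\tau_0,\tau_1,\tau_2,\dots\}$ is a renewal process with i.i.d. increments $\tau_i-\tau_{i-1}$ taking values in $\{1,2,3,\dots\}\cup\{\infty\}$; it is also viewed as a random subset of the nonnegative integers, so that $\{n\in\tau\}=\{\exists k\ge0:\tau_k=n\}$. It may be recurrent ($\mathbf{P}(\tau_1=\infty)=0$) or transient ($\mathbf{P}(\tau_1=\infty)>0$); the event $\{\tau_1>n\}$ includes $\{\tau_1=\infty\}$. A sequence $(a_n)$ of (eventually positive) reals is regularly varying with index $\rho\in\mathbb{R}$ if $a_{\lfloor\lambda n\rfloor}/a_n\to\lambda^\rho$ as $n\to\infty$ for every $\lambda>0$, and slowly varying if it is regularly varying with index $0$. No assumption on the form of $\mathbf{P}(\tau_1=n)$ is made beyond those stated in the claim. *)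

theory Defs
  imports "HOL-Probability.Probability" "HOL-Library.Landau_Symbols" "HOL-Library.Extended_Nat"
begin

definition regularly_varying_index :: "(nat \<Rightarrow> real) \<Rightarrow> real \<Rightarrow> bool" where
  "regularly_varying_index a \<rho> \<longleftrightarrow>
     (\<forall>\<^sub>F n in sequentially. a n > 0) \<and>
     (\<forall>l::real. l > 0 \<longrightarrow> (\<lambda>n. a (nat \<lfloor>l * real n\<rfloor>) / a n) \<longlonglongrightarrow> l powr \<rho>)"

definition regularly_varying :: "(nat \<Rightarrow> real) \<Rightarrow> bool" where
  "regularly_varying a \<longleftrightarrow> (\<exists>\<rho>. regularly_varying_index a \<rho>)"

definition slowly_varying :: "(nat \<Rightarrow> real) \<Rightarrow> bool" where
  "slowly_varying a \<longleftrightarrow> regularly_varying_index a 0"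

(* The process is given through its increments X 0, X 1, ..., where X i stands for
   tau_(i+1) - tau_i.  The increments are the primitive data because a
   difference of two infinite renewal times does not determine an increment. *)

locale renewal_process = prob_space M for M :: "'a measure" +
  fixes X :: "nat \<Rightarrow> 'a \<Rightarrow> enat"
  assumes indep_increments: "indep_vars (\<lambda>_. count_space UNIV) X UNIV"
    and identically_distributed:
      "distr M (count_space UNIV) (X i) = distr M (count_space UNIV) (X 0)"
    and increments_ge_1: "\<omega> \<in> space M \<Longrightarrow> X i \<omega> \<ge> 1"

definition renewal_time :: "(nat \<Rightarrow> 'a \<Rightarrow> enat) \<Rightarrow> nat \<Rightarrow> 'a \<Rightarrow> enat" where
  "renewal_time X k \<omega> = (\<Sum>i<k. X i \<omega>)"

definition renewal_set :: "(nat \<Rightarrow> 'a \<Rightarrow> enat) \<Rightarrow> 'a \<Rightarrow> nat set" where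
  "renewal_set X \<omega> = {n. \<exists>k. renewal_time X k \<omega> = enat n}"

end

theory Submission
  imports Defs
begin

text \<open>
Write f n for P(tau_1 = n), u n for P(n in tau), r n for P(tau_1 > n) and U n for
u 0 + ... + u n.  The renewal equation says that the generating functions satisfy
u(s) (1 - f(s)) = 1, and it follows that u(s) r(s) = 1 / (1 - s).

The tail.  The second identity, summed once more, bounds the partial sums of r by
n / U n up to a factor tending to 1, since U is slowly varying.  As r is monotone, this gives
r n ~ 1 / U n (tail_asymp).  In particular r is slowly varying, and so v = r^2 u is
regularly varying with the index rho of u.  Comparing the growth of u and U shows that
rho \<le> -1 (index_le_minus_1).

The critical index rho = -1.  Differentiating u(s) (1 - f(s)) = 1 gives
f'(s) = u'(s) (1 - f(s))^2, hence s f'(s) / (1 - s)^2 = s u'(s) r(s)^2.  The coefficients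
on the left are the partial sums of T n = sum of j f j over j \<le> n, and those on the right form the
convolution of L n = n u n with r and once more with r.  Now L and r are slowly varying,
and the convolution of slowly varying sequences behaves as if they were constant
(slowly_varying_conv_L1, sum_conv_weighted_tendsto), so the double sum is ~ n^2 L n (r n)^2 / 2.
Since T is monotone, T n ~ n L n (r n)^2 (monotone_density).  Differences of T over the window
((1 - \<epsilon>) n, n] give the average of f there, for each fixed \<epsilon>.

The case rho < -1.  Here u is summable and the increments are infinite with positive
probability.  The same differential equation reads n f n = sum of g j (n - j) u (n - j),
where g has generating function (1 - f(s))^2 and is dominated by u.  Dominated convergence for series yields
f n / u n -> (1 - f(1))^2 = lim (r n)^2, so f ~ v pointwise (asymp_equiv_of_summable).

In both cases the average of f over ((1 - \<epsilon>) n, n] is eventually within a factor 1 + \<eta> of v n, where \<eta>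
is small with \<epsilon>; this is the relation window_equiv.  A diagonal choice of \<epsilon> gives
the first claim (window_equiv_diagonal).  If f is itself regularly varying, then f also
equals its own window averages up to such factors, and comparing the two gives f ~ v
(window_equiv_refl, window_equiv_unique).
\<close>

section \<open>Regularly varying sequences\<close>

lemma filterlim_nat_floor_mult:
  assumes "l > 0"
  shows "filterlim (\<lambda>n. nat \<lfloor>l * real n\<rfloor>) sequentially sequentially"
proof -
  have "filterlim (\<lambda>n. l * real n) at_top sequentially"
    using assms by (intro filterlim_tendsto_pos_mult_at_top[OF tendsto_const _ filterlim_real_sequentially])
  then show ?thesis
    by (intro filterlim_compose[OF filterlim_nat_sequentially]
        filterlim_compose[OF filterlim_floor_sequentially])
qed

lemma regularly_varying_ln_tendsto:
  assumes "regularly_varying_index a \<rho>" "l > 0"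
  shows "(\<lambda>n. ln (a (nat \<lfloor>l * real n\<rfloor>)) - ln (a n) - \<rho> * ln l) \<longlonglongrightarrow> 0"
proof -
  have pos: "\<forall>\<^sub>F n in sequentially. a n > 0"
    and lim: "(\<lambda>n. a (nat \<lfloor>l * real n\<rfloor>) / a n) \<longlonglongrightarrow> l powr \<rho>"
    using assms by (auto simp: regularly_varying_index_def)
  have "(\<lambda>n. ln (a (nat \<lfloor>l * real n\<rfloor>) / a n)) \<longlonglongrightarrow> ln (l powr \<rho>)"
    using assms(2) by (intro tendsto_ln lim) auto
  moreover have "\<forall>\<^sub>F n in sequentially. ln (a (nat \<lfloor>l * real n\<rfloor>) / a n)
      = ln (a (nat \<lfloor>l * real n\<rfloor>)) - ln (a n)"
    using pos filterlim_nat_floor_mult[OF assms(2), unfolded filterlim_iff, rule_format, OF pos]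
    by eventually_elim (simp add: ln_div)
  ultimately have "(\<lambda>n. ln (a (nat \<lfloor>l * real n\<rfloor>)) - ln (a n)) \<longlonglongrightarrow> ln (l powr \<rho>)"
    by (rule Lim_transform_eventually)
  from tendsto_diff[OF this tendsto_const[of "\<rho> * ln l"]] show ?thesis
    using assms(2) by (simp add: ln_powr)
qed

text \<open>
The uniform convergence theorem.  By Egorov's argument the set of bad ratios \<mu>,
for which the limit defining regular variation is not yet attained to within \<eta>/2 at some later index,
has small Lebesgue measure.  To compare the indices k and n = c k, one picks a \<mu> in [1,2]
such that both \<mu> and c \<mu> are good.  As \<mu> n and (c \<mu>) k are the same
number, a n and a k are both compared with the same term of the sequence.
\<close>

lemma regularly_varying_uniform:
  assumes rv: "regularly_varying_index a \<rho>" and "\<Lambda> \<ge> 1" "\<eta> > 0"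
  shows "\<forall>\<^sub>F k in sequentially. \<forall>n. k \<le> n \<and> real n \<le> \<Lambda> * real k \<longrightarrow>
           \<bar>ln (a n) - ln (a k) - \<rho> * ln (real n / real k)\<bar> \<le> \<eta>"
proof -
  define h where "h n \<mu> = ln (a (nat \<lfloor>\<mu> * real n\<rfloor>)) - ln (a n) - \<rho> * ln \<mu>" for n \<mu>
  \<comment> \<open>The bad ratios decrease to the empty set; the range up to 2 \<Lambda> leaves room for c \<mu>.\<close>
  define D where "D N = {\<mu>\<in>{1..2*\<Lambda>}. \<exists>n\<ge>N. \<bar>h n \<mu>\<bar> > \<eta>/2}" for N
  have [measurable]: "h n \<in> borel_measurable borel" for n
  proof -
    have "(\<lambda>x. ln (a (nat x))) \<in> measurable (count_space UNIV) borel" by simp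
    from measurable_compose[OF _ this, of "\<lambda>x. \<lfloor>x * real n\<rfloor>" borel]
    have "(\<lambda>x. ln (a (nat \<lfloor>x * real n\<rfloor>))) \<in> borel_measurable borel" by measurable
    then show ?thesis unfolding h_def by measurable
  qed
  have D_meas [measurable]: "D N \<in> sets borel" for N
    unfolding D_def by measurable
  have D_dec: "decseq D" by (auto simp: decseq_def D_def intro: order_trans)
  have D_empty: "(\<Inter>N. D N) = {}"
  proof (safe, rule ccontr)
    fix \<mu> assume "\<mu> \<in> (\<Inter>N. D N)"
    then have \<mu>: "\<mu> \<ge> 1" and ex: "\<exists>n\<ge>N. \<bar>h n \<mu>\<bar> > \<eta>/2" for N by (auto simp: D_def)
    have "(\<lambda>n. h n \<mu>) \<longlonglongrightarrow> 0"
      unfolding h_def using \<mu> by (intro regularly_varying_ln_tendsto[OF rv]) auto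
    then have "\<forall>\<^sub>F n in sequentially. dist (h n \<mu>) 0 < \<eta>/2"
      using \<open>\<eta> > 0\<close> by (intro tendstoD) auto
    then obtain N where "\<And>n. n \<ge> N \<Longrightarrow> \<bar>h n \<mu>\<bar> < \<eta>/2"
      by (auto simp: eventually_sequentially)
    with ex[of N] show False by (meson less_asym)
  qed
  have "(\<lambda>N. emeasure lborel (D N)) \<longlonglongrightarrow> emeasure lborel (\<Inter>N. D N)"
  proof (rule Lim_emeasure_decseq[OF _ D_dec])
    show "range D \<subseteq> sets lborel" by auto
    have "emeasure lborel (D N) \<le> emeasure lborel {1..2*\<Lambda>}" for N
      by (rule emeasure_mono) (auto simp: D_def)
    then show "emeasure lborel (D N) \<noteq> \<infinity>" for N
      using assms(2) by (metis emeasure_lborel_Icc_eq ennreal_less_top infinity_ennreal_def leD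
          ennreal_neq_top top.not_eq_extremum)
  qed
  then have "(\<lambda>N. emeasure lborel (D N)) \<longlonglongrightarrow> 0" by (simp only: D_empty emeasure_empty)
  then have "\<forall>\<^sub>F N in sequentially. emeasure lborel (D N) < 1/4"
    by (rule order_tendstoD(2)) (simp add: ennreal_zero_less_divide)
  then obtain N where N: "emeasure lborel (D N) < 1/4" by (auto simp: eventually_sequentially)
  show ?thesis
    using eventually_ge_at_top[of "max N 1"]
  proof eventually_elim
    case (elim k)
    show ?case
    proof safe
      fix n assume kn: "k \<le> n" "real n \<le> \<Lambda> * real k"
      define c where "c = real n / real k"
      have c: "1 \<le> c" "c \<le> \<Lambda>" using kn elim by (auto simp: c_def field_simps)
      have "emeasure lborel ((*) c -` D N) = emeasure (distr lborel borel ((*) c)) (D N)"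
        by (subst emeasure_distr) auto
      also have "\<dots> = ennreal (inverse c) * emeasure lborel (D N)"
        using c by (subst lborel_distr_mult) (auto simp: emeasure_density nn_integral_cmult)
      also have "\<dots> \<le> 1 * emeasure lborel (D N)"
        using c by (intro mult_right_mono) (auto simp: ennreal_le_1 inverse_le_1_iff)
      finally have 1: "emeasure lborel ((*) c -` D N) < 1/4" using N by simp
      have meas: "(*) c -` D N \<in> sets borel"
        using measurable_sets_borel[of "(*) c" borel "D N"] by simp
      have "\<exists>\<mu>\<in>{1..2}. \<mu> \<notin> D N \<and> c * \<mu> \<notin> D N"
      proof (rule ccontr)
        assume "\<not> ?thesis"
        then have "{1..2} \<subseteq> D N \<union> (*) c -` D N" by auto
        then have "emeasure lborel {1..2::real} \<le> emeasure lborel (D N \<union> (*) c -` D N)"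
          using meas by (intro emeasure_mono) auto
        also have "\<dots> \<le> emeasure lborel (D N) + emeasure lborel ((*) c -` D N)"
          using meas by (intro emeasure_subadditive) auto
        also have "\<dots> < 1/4 + 1/4" using 1 N by (rule add_strict_mono[rotated])
        finally have "1 < ennreal (1/4) + ennreal (1/4)"
          by (simp add: ennreal_divide_numeral flip: ennreal_1)
        then have "1 < ennreal (1/2)" by (simp flip: ennreal_plus)
        moreover have "ennreal (1/2) \<le> ennreal 1" by (rule ennreal_leI) simp
        ultimately show False by simp
      qed
      then obtain \<mu> where \<mu>: "1 \<le> \<mu>" "\<mu> \<le> 2" "\<mu> \<notin> D N" "c * \<mu> \<notin> D N" by auto
      have "c * \<mu> \<le> \<Lambda> * 2" using \<mu> c by (intro mult_mono) auto
      moreover have "1 * 1 \<le> c * \<mu>" using \<mu> c by (intro mult_mono) auto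
      ultimately have h1: "\<bar>h k (c * \<mu>)\<bar> \<le> \<eta>/2" and h2: "\<bar>h n \<mu>\<bar> \<le> \<eta>/2"
        using \<mu> elim kn assms(2) by (auto simp: D_def not_less)
      \<comment> \<open>The two terms of the sequence compared with a k and a n have the same index.\<close>
      have eq: "c * \<mu> * real k = \<mu> * real n" using elim by (simp add: c_def)
      have "ln (a n) - ln (a k) - \<rho> * ln c = h k (c * \<mu>) - h n \<mu>"
        unfolding h_def eq using c \<mu> by (simp add: ln_mult algebra_simps)
      then show "\<bar>ln (a n) - ln (a k) - \<rho> * ln (real n / real k)\<bar> \<le> \<eta>"
        using h1 h2 unfolding c_def by linarith
    qed
  qed
qed

lemma regularly_varying_index_mult:
  assumes "regularly_varying_index a \<rho>" "regularly_varying_index b \<sigma>"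
  shows "regularly_varying_index (\<lambda>n. a n * b n) (\<rho> + \<sigma>)"
  unfolding regularly_varying_index_def
proof (intro conjI allI impI)
  show "\<forall>\<^sub>F n in sequentially. a n * b n > 0"
    using assms unfolding regularly_varying_index_def by (auto elim: eventually_elim2)
  fix l :: real assume "l > 0"
  then have "(\<lambda>n. (a (nat \<lfloor>l * real n\<rfloor>) / a n) * (b (nat \<lfloor>l * real n\<rfloor>) / b n))
      \<longlonglongrightarrow> l powr \<rho> * l powr \<sigma>"
    using assms unfolding regularly_varying_index_def by (intro tendsto_mult) auto
  then show "(\<lambda>n. a (nat \<lfloor>l * real n\<rfloor>) * b (nat \<lfloor>l * real n\<rfloor>) / (a n * b n)) \<longlonglongrightarrow> l powr (\<rho> + \<sigma>)"
    by (simp add: powr_add)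
qed

lemma regularly_varying_index_inverse:
  assumes "regularly_varying_index a \<rho>"
  shows "regularly_varying_index (\<lambda>n. inverse (a n)) (- \<rho>)"
  unfolding regularly_varying_index_def
proof (intro conjI allI impI)
  show "\<forall>\<^sub>F n in sequentially. inverse (a n) > 0"
    using assms unfolding regularly_varying_index_def by (auto elim: eventually_mono)
  fix l :: real assume "l > 0"
  then have "(\<lambda>n. inverse (a (nat \<lfloor>l * real n\<rfloor>) / a n)) \<longlonglongrightarrow> inverse (l powr \<rho>)"
    using assms unfolding regularly_varying_index_def by (intro tendsto_inverse) auto
  then show "(\<lambda>n. inverse (a (nat \<lfloor>l * real n\<rfloor>)) / inverse (a n)) \<longlonglongrightarrow> l powr - \<rho>"
    by (simp add: powr_minus field_simps)
qed

text \<open>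
Each factor of a quotient may be replaced by an equivalent one, and the index
nat \<lfloor>l n\<rfloor> tends to infinity with n.
\<close>

lemma regularly_varying_index_asymp_equiv:
  assumes "regularly_varying_index a \<rho>" "b \<sim>[sequentially] a"
  shows "regularly_varying_index b \<rho>"
  unfolding regularly_varying_index_def
proof (intro conjI allI impI)
  have pos: "\<forall>\<^sub>F n in sequentially. a n > 0"
    using assms(1) by (auto simp: regularly_varying_index_def)
  have "\<forall>\<^sub>F n in sequentially. (if b n = 0 \<and> a n = 0 then 1 else b n / a n) > 0"
    using asymp_equivD[OF assms(2)] by (rule order_tendstoD) simp
  then show "\<forall>\<^sub>F n in sequentially. b n > 0"
    using pos by eventually_elim (auto simp: zero_less_divide_iff)
  fix l :: real assume l: "l > 0"
  have "(\<lambda>n. b (nat \<lfloor>l * real n\<rfloor>)) \<sim>[sequentially] (\<lambda>n. a (nat \<lfloor>l * real n\<rfloor>))"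
    by (rule asymp_equiv_compose'[OF assms(2) filterlim_nat_floor_mult[OF l]])
  then have "(\<lambda>n. b (nat \<lfloor>l * real n\<rfloor>) / b n) \<sim>[sequentially] (\<lambda>n. a (nat \<lfloor>l * real n\<rfloor>) / a n)"
    by (intro asymp_equiv_divide assms(2))
  moreover have "(\<lambda>n. a (nat \<lfloor>l * real n\<rfloor>) / a n) \<longlonglongrightarrow> l powr \<rho>"
    using assms(1) l by (auto simp: regularly_varying_index_def)
  ultimately show "(\<lambda>n. b (nat \<lfloor>l * real n\<rfloor>) / b n) \<longlonglongrightarrow> l powr \<rho>"
    using asymp_equiv_symI asymp_equiv_tendsto_transfer by blast
qed

lemma nat_floor_mult_over_tendsto:
  assumes "l > 0"
  shows "(\<lambda>n. real (nat \<lfloor>l * real n\<rfloor>) / real n) \<longlonglongrightarrow> l"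
proof (rule tendsto_sandwich[of "\<lambda>n. l - 1 / real n" _ _ "\<lambda>_. l"])
  have *: "l * real n - 1 < real (nat \<lfloor>l * real n\<rfloor>) \<and> real (nat \<lfloor>l * real n\<rfloor>) \<le> l * real n" for n
  proof -
    have "0 \<le> l * real n" using assms by simp
    then show ?thesis by linarith
  qed
  show "\<forall>\<^sub>F n in sequentially. l - 1 / real n \<le> real (nat \<lfloor>l * real n\<rfloor>) / real n"
    using eventually_gt_at_top[of 0]
  proof eventually_elim
    case (elim n)
    have "(l - 1 / real n) * real n \<le> real (nat \<lfloor>l * real n\<rfloor>)"
      using *[of n] elim by (simp add: left_diff_distrib)
    then show ?case using elim by (simp add: pos_le_divide_eq)
  qed
  show "\<forall>\<^sub>F n in sequentially. real (nat \<lfloor>l * real n\<rfloor>) / real n \<le> l"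
    using eventually_gt_at_top[of 0]
    by eventually_elim (use * in \<open>simp add: pos_divide_le_eq\<close>)
  show "(\<lambda>n. l - 1 / real n) \<longlonglongrightarrow> l"
    using tendsto_diff[OF tendsto_const lim_1_over_n, of l] by simp
qed simp

lemma regularly_varying_index_powr:
  "regularly_varying_index (\<lambda>n. real n powr \<rho>) \<rho>"
  unfolding regularly_varying_index_def
proof (intro conjI allI impI)
  show "\<forall>\<^sub>F n in sequentially. real n powr \<rho> > 0"
    using eventually_gt_at_top[of 0] by eventually_elim simp
  fix l :: real assume l: "l > 0"
  have "(\<lambda>n. (real (nat \<lfloor>l * real n\<rfloor>) / real n) powr \<rho>) \<longlonglongrightarrow> l powr \<rho>"
    using nat_floor_mult_over_tendsto[OF l] l by (intro tendsto_powr tendsto_const) auto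
  then show "(\<lambda>n. real (nat \<lfloor>l * real n\<rfloor>) powr \<rho> / real n powr \<rho>) \<longlonglongrightarrow> l powr \<rho>"
    by (simp add: powr_divide)
qed

lemma slowly_varying_uniform:
  assumes "slowly_varying a" "\<Lambda> \<ge> 1" "\<eta> > 0"
  shows "\<forall>\<^sub>F k in sequentially. \<forall>n. k \<le> n \<and> real n \<le> \<Lambda> * real k \<longrightarrow> \<bar>ln (a n) - ln (a k)\<bar> \<le> \<eta>"
  using regularly_varying_uniform[of a 0 \<Lambda> \<eta>] assms by (simp add: slowly_varying_def)

text \<open>
Potter's bounds.  Going from k to n by doublings, each of the about log2 (n/k) steps
changes ln a by at most \<eta> ln 2.
\<close>

lemma slowly_varying_Potter:
  assumes sv: "slowly_varying a" and "\<eta> > 0"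
  obtains N where "N > 0"
    "\<And>n. n \<ge> N \<Longrightarrow> a n > 0"
    "\<And>k n. N \<le> k \<Longrightarrow> k \<le> n \<Longrightarrow> \<bar>ln (a n) - ln (a k)\<bar> \<le> \<eta> + \<eta> * ln (real n / real k)"
proof -
  have "\<forall>\<^sub>F n in sequentially. a n > 0"
    using sv by (auto simp: slowly_varying_def regularly_varying_index_def)
  moreover have "\<forall>\<^sub>F k in sequentially. \<forall>n. k \<le> n \<and> real n \<le> 2 * real k \<longrightarrow> \<bar>ln (a n) - ln (a k)\<bar> \<le> \<eta> * ln 2"
    using assms by (intro slowly_varying_uniform) auto
  ultimately have "\<forall>\<^sub>F k in sequentially. a k > 0 \<and> k > 0 \<and>
      (\<forall>n. k \<le> n \<and> real n \<le> 2 * real k \<longrightarrow> \<bar>ln (a n) - ln (a k)\<bar> \<le> \<eta> * ln 2)"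
    using eventually_gt_at_top[of 0] by eventually_elim auto
  then obtain N where N: "\<And>k. k \<ge> N \<Longrightarrow> a k > 0" "\<And>k. k \<ge> N \<Longrightarrow> k > 0"
    "\<And>k n. k \<ge> N \<Longrightarrow> k \<le> n \<Longrightarrow> real n \<le> 2 * real k \<Longrightarrow> \<bar>ln (a n) - ln (a k)\<bar> \<le> \<eta> * ln 2"
    unfolding eventually_sequentially by blast
  have ln2: "ln (2::real) \<le> 1" using ln_le_minus_one[of 2] by simp
  have *: "\<bar>ln (a n) - ln (a k)\<bar> \<le> \<eta> + \<eta> * ln (real n / real k)" if "N \<le> k" "k \<le> n" for k n
    using that
  proof (induction "n - k" arbitrary: k rule: less_induct)
    case less
    have k: "k > 0" using N(2) less by auto
    show ?case
    proof (cases "n \<le> 2 * k")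
      case True
      have "\<bar>ln (a n) - ln (a k)\<bar> \<le> \<eta> * ln 2" using N(3) less True by auto
      also have "\<dots> \<le> \<eta>" using ln2 \<open>\<eta> > 0\<close> by (simp add: mult_left_le)
      also have "\<dots> \<le> \<eta> + \<eta> * ln (real n / real k)"
        using k less.prems \<open>\<eta> > 0\<close> by simp
      finally show ?thesis .
    next
      case False
      have "\<bar>ln (a n) - ln (a (2*k))\<bar> \<le> \<eta> + \<eta> * ln (real n / real (2*k))"
        using less False k by (intro less) auto
      moreover have "\<bar>ln (a (2*k)) - ln (a k)\<bar> \<le> \<eta> * ln 2" using N(3)[of k "2*k"] less by auto
      moreover have "ln (real n / real (2*k)) = ln (real n / real k) - ln 2"
        using k False by (simp add: ln_div ln_mult)
      then have "\<eta> * ln (real n / real (2*k)) = \<eta> * ln (real n / real k) - \<eta> * ln 2"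
        by (simp only: right_diff_distrib)
      ultimately show ?thesis by linarith
    qed
  qed
  show ?thesis using that[of N] * N by auto
qed

lemma slowly_varying_powr_bounds:
  assumes sv: "slowly_varying a" and "\<eta> > 0"
  obtains c C where "c > 0" "C > 0"
    "\<forall>\<^sub>F n in sequentially. c * real n powr - \<eta> \<le> a n \<and> a n \<le> C * real n powr \<eta>"
proof -
  obtain N where N: "N > 0" "\<And>n. n \<ge> N \<Longrightarrow> a n > 0"
    "\<And>k n. N \<le> k \<Longrightarrow> k \<le> n \<Longrightarrow> \<bar>ln (a n) - ln (a k)\<bar> \<le> \<eta> + \<eta> * ln (real n / real k)"
    using slowly_varying_Potter[OF assms] by metis
  define e where "e = \<eta> - \<eta> * ln (real N)"
  show ?thesis
  proof (rule that[of "exp (ln (a N) - e)" "exp (ln (a N) + e)"])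
    show "\<forall>\<^sub>F n in sequentially. exp (ln (a N) - e) * real n powr - \<eta> \<le> a n \<and>
        a n \<le> exp (ln (a N) + e) * real n powr \<eta>"
      using eventually_ge_at_top[of N]
    proof eventually_elim
      case (elim n)
      have "\<bar>ln (a n) - ln (a N)\<bar> \<le> e + \<eta> * ln (real n)"
        using N(3)[OF order_refl elim] N(1) elim by (simp add: ln_div e_def algebra_simps)
      then have "ln (a N) - e - \<eta> * ln (real n) \<le> ln (a n)" "ln (a n) \<le> ln (a N) + e + \<eta> * ln (real n)"
        by linarith+
      then have "exp (ln (a N) - e - \<eta> * ln (real n)) \<le> a n" "a n \<le> exp (ln (a N) + e + \<eta> * ln (real n))"
        using N(2)[OF elim] by (metis exp_le_cancel_iff exp_ln)+
      then show ?case using N(1) elim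
        by (simp add: powr_def exp_add exp_diff exp_minus field_simps)
    qed
  qed auto
qed

text \<open>
The form of Potter's bound used for convolutions.  It covers all indices k down to 0, which is
why the ratio is shifted by one; the exponent 1/2 is a convenient number below 1, making the
bound summable in k up to the right order.
\<close>

lemma slowly_varying_Potter_sqrt:
  assumes sv: "slowly_varying a"
  obtains N C where "C > 0" "\<And>k n. n \<ge> N \<Longrightarrow> k \<le> n \<Longrightarrow> a k \<le> C * sqrt ((real n + 1) / (real k + 1)) * a n"
proof -
  obtain N where N: "N > 0" "\<And>n. n \<ge> N \<Longrightarrow> a n > 0"
    "\<And>k n. N \<le> k \<Longrightarrow> k \<le> n \<Longrightarrow> \<bar>ln (a n) - ln (a k)\<bar> \<le> 1/2 + 1/2 * ln (real n / real k)"
    using slowly_varying_Potter[OF sv, of "1/2"] by auto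
  have big: "a k \<le> 4 * sqrt ((real n + 1) / (real k + 1)) * a n" if "N \<le> k" "k \<le> n" for k n
  proof -
    have k: "k > 0" using N(1) that by auto
    have "ln (a k) \<le> ln (a n) + (1/2 + 1/2 * ln (real n / real k))" using N(3)[OF that] by linarith
    then have "exp (ln (a k)) \<le> exp (ln (a n) + (1/2 + 1/2 * ln (real n / real k)))" by simp
    also have "\<dots> = a n * (exp (1/2) * exp (ln (real n / real k) / 2))"
      using N(2)[of n] that by (simp add: exp_add)
    also have "exp (ln (real n / real k) / 2) = sqrt (real n / real k)"
      using k that by (simp flip: powr_half_sqrt add: powr_def)
    also have "a n * (exp (1/2) * sqrt (real n / real k)) \<le> a n * (2 * sqrt (4 * ((real n + 1) / (real k + 1))))"
    proof (intro mult_left_mono mult_mono)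
      show "exp (1/2) \<le> (2::real)" using exp_half_le2 by simp
      have "real n / real k \<le> 4 * ((real n + 1) / (real k + 1))"
      proof -
        have "real n * 1 \<le> real n * real k" using k by (intro mult_left_mono) auto
        then have "real n * (real k + 1) \<le> (4 * (real n + 1)) * real k" by (simp add: algebra_simps)
        then have "real n / real k \<le> (4 * (real n + 1)) / (real k + 1)"
          using k by (simp add: divide_le_eq pos_le_divide_eq mult.commute)
        then show ?thesis by simp
      qed
      then show "sqrt (real n / real k) \<le> sqrt (4 * ((real n + 1) / (real k + 1)))" by simp
    qed (use N(2)[of n] that in auto)
    also have "sqrt (4 * ((real n + 1) / (real k + 1))) = 2 * sqrt ((real n + 1) / (real k + 1))"
      by (simp only: real_sqrt_mult real_sqrt_four)
    finally show ?thesis using N(2)[of k] that by (simp only: exp_ln mult_ac)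
  qed
  \<comment> \<open>The maximum takes care of the finitely many indices below the threshold of Potter's bound.\<close>
  define C where "C = 4 + Max ((\<lambda>k. 4 * \<bar>a k\<bar> / a N * sqrt (real N + 1)) ` {..N})"
  have M: "4 * \<bar>a k\<bar> / a N * sqrt (real N + 1) \<le> C - 4" if "k \<le> N" for k
  proof -
    have "4 * \<bar>a k\<bar> / a N * sqrt (real N + 1) \<le> Max ((\<lambda>k. 4 * \<bar>a k\<bar> / a N * sqrt (real N + 1)) ` {..N})"
      by (rule Max_ge) (use that in \<open>auto intro!: image_eqI[of _ _ k]\<close>)
    then show ?thesis unfolding C_def by linarith
  qed
  have "4 * \<bar>a 0\<bar> / a N * sqrt (real N + 1) \<ge> 0" using N(2)[of N] by simp
  with M[of 0] have C4: "C \<ge> 4" by simp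
  show ?thesis
  proof (rule that[of C N])
    show "C > 0" using C4 by simp
    fix k n assume kn: "N \<le> n" "k \<le> n"
    have an: "a n > 0" using N(2) kn by auto
    show "a k \<le> C * sqrt ((real n + 1) / (real k + 1)) * a n"
    proof (cases "N \<le> k")
      case True
      have "a k \<le> 4 * sqrt ((real n + 1) / (real k + 1)) * a n" using big[OF True kn(2)] .
      also have "\<dots> \<le> C * sqrt ((real n + 1) / (real k + 1)) * a n"
        using C4 an by (intro mult_right_mono) auto
      finally show ?thesis .
    next
      case False
      have aN: "a N > 0" using N(2) by auto
      have "a N \<le> 4 * sqrt ((real n + 1) / (real N + 1)) * a n" using big kn by auto
      also have "\<dots> \<le> 4 * sqrt (real N + 1) * sqrt ((real n + 1) / (real k + 1)) * a n"
      proof (intro mult_right_mono)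
        have "(real n + 1) / (real N + 1) \<le> (real n + 1) / (real k + 1)"
          using False by (intro divide_left_mono) auto
        moreover have "1 * ((real n + 1) / (real k + 1)) \<le> (real N + 1) * ((real n + 1) / (real k + 1))"
          by (intro mult_right_mono) auto
        ultimately have "(real n + 1) / (real N + 1) \<le> (real N + 1) * ((real n + 1) / (real k + 1))" by linarith
        then have "sqrt ((real n + 1) / (real N + 1)) \<le> sqrt ((real N + 1) * ((real n + 1) / (real k + 1)))" by simp
        then show "4 * sqrt ((real n + 1) / (real N + 1)) \<le> 4 * sqrt (real N + 1) * sqrt ((real n + 1) / (real k + 1))"
          by (simp only: real_sqrt_mult mult.assoc)
      qed (use an in auto)
      finally have "a N \<le> 4 * sqrt (real N + 1) * sqrt ((real n + 1) / (real k + 1)) * a n" .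
      then have "\<bar>a k\<bar> / a N * a N \<le> \<bar>a k\<bar> / a N * (4 * sqrt (real N + 1) * sqrt ((real n + 1) / (real k + 1)) * a n)"
        using aN by (intro mult_left_mono) auto
      also have "\<bar>a k\<bar> / a N * a N = \<bar>a k\<bar>" using aN by simp
      also have "\<bar>a k\<bar> / a N * (4 * sqrt (real N + 1) * sqrt ((real n + 1) / (real k + 1)) * a n)
          = (4 * \<bar>a k\<bar> / a N * sqrt (real N + 1)) * (sqrt ((real n + 1) / (real k + 1)) * a n)"
        by (simp only: mult_ac times_divide_eq_left times_divide_eq_right)
      also have "\<dots> \<le> C * (sqrt ((real n + 1) / (real k + 1)) * a n)"
        using M[of k] False an by (intro mult_right_mono) auto
      finally show ?thesis by (simp add: mult.assoc)
    qed
  qed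
qed

text \<open>
Translates the logarithmic estimates of the uniform convergence theorem into relative errors.
\<close>

lemma abs_diff_le_of_abs_ln_diff_le:
  fixes x y \<eta> :: real
  assumes "x > 0" "y > 0" "\<eta> > 0" "\<bar>ln x - ln y\<bar> \<le> ln (1 + \<eta>)"
  shows "\<bar>x - y\<bar> \<le> \<eta> * y"
proof -
  have "ln x \<le> ln (y * (1 + \<eta>))" "ln (y / (1 + \<eta>)) \<le> ln x"
    using assms by (auto simp: ln_mult ln_div)
  then have "x \<le> y * (1 + \<eta>)" "y / (1 + \<eta>) \<le> x" using assms by auto
  moreover have "y - \<eta> * y \<le> y / (1 + \<eta>)"
  proof -
    have "y - (y - \<eta> * y) * (1 + \<eta>) = y * \<eta>\<^sup>2" by (simp add: power2_eq_square algebra_simps)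
    also have "\<dots> \<ge> 0" using assms by simp
    finally show ?thesis using assms by (simp add: pos_le_divide_eq)
  qed
  moreover have "y * (1 + \<eta>) = y + \<eta> * y" by (simp add: algebra_simps)
  ultimately show ?thesis by linarith
qed

text \<open>
Uniform convergence seen from the larger index n, the form in which windows and convolutions use it.
\<close>

lemma regularly_varying_uniform_below:
  assumes rv: "regularly_varying_index a \<rho>" and "0 < \<delta>" "\<delta> \<le> 1" "\<eta> > 0"
  shows "\<forall>\<^sub>F n in sequentially. \<forall>k. \<delta> * real n \<le> real k \<and> k \<le> n \<longrightarrow>
           a k > 0 \<and> \<bar>ln (a k) - ln (a n) - \<rho> * ln (real k / real n)\<bar> \<le> \<eta>"
proof -
  have "\<forall>\<^sub>F n in sequentially. a n > 0"
    using rv by (auto simp: regularly_varying_index_def)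
  moreover have "\<forall>\<^sub>F k in sequentially. \<forall>n. k \<le> n \<and> real n \<le> (1/\<delta>) * real k \<longrightarrow>
      \<bar>ln (a n) - ln (a k) - \<rho> * ln (real n / real k)\<bar> \<le> \<eta>"
    using assms by (intro regularly_varying_uniform) auto
  ultimately have "\<forall>\<^sub>F k in sequentially. a k > 0 \<and> k > 0 \<and> (\<forall>n. k \<le> n \<and> real n \<le> (1/\<delta>) * real k \<longrightarrow>
      \<bar>ln (a n) - ln (a k) - \<rho> * ln (real n / real k)\<bar> \<le> \<eta>)"
    using eventually_gt_at_top[of 0] by eventually_elim auto
  then obtain N where N: "\<And>k. k \<ge> N \<Longrightarrow> a k > 0" "\<And>k. k \<ge> N \<Longrightarrow> k > 0"
    "\<And>k n. k \<ge> N \<Longrightarrow> k \<le> n \<Longrightarrow> real n \<le> (1/\<delta>) * real k \<Longrightarrow>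
      \<bar>ln (a n) - ln (a k) - \<rho> * ln (real n / real k)\<bar> \<le> \<eta>"
    unfolding eventually_sequentially by blast
  have "\<forall>\<^sub>F n in sequentially. \<delta> * real n \<ge> real N"
    using filterlim_tendsto_pos_mult_at_top[OF tendsto_const assms(2) filterlim_real_sequentially]
    by (simp add: filterlim_at_top)
  then show ?thesis
  proof eventually_elim
    case (elim n)
    show ?case
    proof (intro allI impI)
      fix k assume k: "\<delta> * real n \<le> real k \<and> k \<le> n"
      then have kN: "k \<ge> N" "real n \<le> (1/\<delta>) * real k" using elim assms by (auto simp: field_simps)
      then have "\<rho> * ln (real k / real n) = - (\<rho> * ln (real n / real k))"
        using N(2)[OF kN(1)] k by (simp add: ln_div algebra_simps)
      with N(1)[OF kN(1)] N(3)[OF kN(1) _ kN(2)] k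
      show "a k > 0 \<and> \<bar>ln (a k) - ln (a n) - \<rho> * ln (real k / real n)\<bar> \<le> \<eta>" by simp
    qed
  qed
qed

lemma slowly_varying_uniform_below:
  assumes "slowly_varying a" "0 < \<delta>" "\<delta> \<le> 1" "\<eta> > 0"
  shows "\<forall>\<^sub>F n in sequentially. \<forall>k. \<delta> * real n \<le> real k \<and> k \<le> n \<longrightarrow> a k > 0 \<and> \<bar>ln (a k) - ln (a n)\<bar> \<le> \<eta>"
  using regularly_varying_uniform_below[of a 0 \<delta> \<eta>] assms by (simp add: slowly_varying_def)

section \<open>Convolutions of slowly varying sequences\<close>

text \<open>
The increments of 2 sqrt m dominate the summands.
\<close>

lemma sum_inverse_sqrt_le: "(\<Sum>k<m. 1 / sqrt (real k + 1)) \<le> 2 * sqrt (real m)"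
proof (induction m)
  case (Suc m)
  define s t where "s = sqrt (real m)" and "t = sqrt (real m + 1)"
  have st: "0 \<le> s" "s \<le> t" "0 < t" "t^2 = s^2 + 1" by (simp_all add: s_def t_def)
  have "0 \<le> (t - s)^2" by simp
  then have "1 \<le> (2 * t - 2 * s) * t" using st(4) by (simp add: power2_eq_square algebra_simps)
  then have "1 / t \<le> 2 * t - 2 * s" using st by (simp add: divide_le_eq)
  with Suc show ?case by (simp add: s_def t_def add.commute)
qed simp

text \<open>
The first \<delta> n terms contribute a negligible share to a sum of order n a n.  By Potter's
bound their sum is of order sqrt (\<delta>) n a n.
\<close>

lemma slowly_varying_initial_sum:
  assumes sv: "slowly_varying a" and "\<eta> > 0"
  obtains \<delta> where "0 < \<delta>" "\<delta> < 1/2"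
    "\<forall>\<^sub>F n in sequentially. (\<Sum>k | real k < \<delta> * real n. a k) \<le> \<eta> * real n * a n"
proof -
  obtain N C where C: "C > 0" and N: "\<And>k n. n \<ge> N \<Longrightarrow> k \<le> n \<Longrightarrow> a k \<le> C * sqrt ((real n + 1) / (real k + 1)) * a n"
    using slowly_varying_Potter_sqrt[OF sv] by metis
  \<comment> \<open>The bound below is 4 C sqrt \<delta> n (a n).\<close>
  define \<delta> where "\<delta> = min (1/4) ((\<eta> / (4 * C))\<^sup>2)"
  have \<delta>: "0 < \<delta>" "\<delta> < 1/2" using assms(2) C by (auto simp: \<delta>_def)
  have "sqrt \<delta> \<le> sqrt ((\<eta> / (4 * C))\<^sup>2)" unfolding \<delta>_def by (intro real_sqrt_le_mono) auto
  also have "\<dots> = \<eta> / (4 * C)" using assms(2) C by (simp only: real_sqrt_abs) simp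
  finally have "sqrt \<delta> \<le> \<eta> / (4 * C)" .
  then have sq\<delta>: "4 * C * sqrt \<delta> \<le> \<eta>" using assms(2) C by (simp add: field_simps)
  have "\<forall>\<^sub>F n in sequentially. a n > 0"
    using sv by (auto simp: slowly_varying_def regularly_varying_index_def)
  moreover have "\<forall>\<^sub>F n in sequentially. \<delta> * real n \<ge> 1"
    using filterlim_tendsto_pos_mult_at_top[OF tendsto_const \<delta>(1) filterlim_real_sequentially]
    by (simp add: filterlim_at_top)
  ultimately have "\<forall>\<^sub>F n in sequentially. (\<Sum>k | real k < \<delta> * real n. a k) \<le> \<eta> * real n * a n"
    using eventually_ge_at_top[of "max N 1"]
  proof eventually_elim
    case (elim n)
    define m where "m = nat \<lceil>\<delta> * real n\<rceil>"
    have m: "{k. real k < \<delta> * real n} = {..<m}" unfolding m_def by (auto, linarith+)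
    have "0 \<le> \<delta> * real n" using \<delta> by simp
    then have "real m \<le> \<delta> * real n + 1" unfolding m_def by linarith
    then have m2: "real m \<le> 2 * \<delta> * real n" using elim by linarith
    have "2 * \<delta> * real n \<le> 1 * real n" using \<delta> by (intro mult_right_mono) auto
    then have mn: "m \<le> n" using m2 by simp
    have "(\<Sum>k | real k < \<delta> * real n. a k) \<le> (\<Sum>k<m. (C * sqrt (real n + 1) * a n) * (1 / sqrt (real k + 1)))"
      unfolding m using N[of n] mn elim by (intro sum_mono) (auto simp: real_sqrt_divide)
    also have "\<dots> = (C * sqrt (real n + 1) * a n) * (\<Sum>k<m. 1 / sqrt (real k + 1))"
      by (rule sum_distrib_left[symmetric])
    also have "\<dots> \<le> (C * sqrt (real n + 1) * a n) * (2 * sqrt (real m))"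
      using C elim by (intro mult_left_mono sum_inverse_sqrt_le) auto
    also have "\<dots> = 2 * C * a n * sqrt ((real n + 1) * real m)"
      by (simp add: real_sqrt_mult)
    also have "\<dots> \<le> 2 * C * a n * sqrt ((2 * real n) * (2 * \<delta> * real n))"
      using C elim m2 by (intro mult_left_mono real_sqrt_le_mono mult_mono) auto
    also have "(2 * real n) * (2 * \<delta> * real n) = (2 * real n)\<^sup>2 * \<delta>" by (simp add: power2_eq_square)
    also have "sqrt ((2 * real n)\<^sup>2 * \<delta>) = 2 * real n * sqrt \<delta>" by (simp add: real_sqrt_mult)
    also have "2 * C * a n * (2 * real n * sqrt \<delta>) = (4 * C * sqrt \<delta>) * (real n * a n)" by simp
    also have "\<dots> \<le> \<eta> * (real n * a n)" using sq\<delta> elim by (intro mult_right_mono) auto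
    finally show ?case by (simp add: mult.assoc)
  qed
  with \<delta> show ?thesis by (rule that)
qed

text \<open>
For k \<le> n/2 the factor b (n - k) is comparable to b n throughout.  For k \<ge> \<delta> n
the product is close to a n * b n; the terms with k < \<delta> n
are few and carry a small part of the sum of a.
\<close>

lemma slowly_varying_conv_half:
  assumes a: "slowly_varying a" and b: "slowly_varying b"
    and a0: "\<And>n. a n \<ge> 0" and "\<eta> > 0"
  shows "\<forall>\<^sub>F n in sequentially. (\<Sum>k | 2 * k \<le> n. \<bar>a k * b (n - k) - a n * b n\<bar>) \<le> \<eta> * (real n * a n * b n)"
proof -
  define \<eta>' where "\<eta>' = min 1 (\<eta> / 8)"
  have \<eta>': "\<eta>' > 0" "\<eta>' \<le> 1" "8 * \<eta>' \<le> \<eta>" using \<open>\<eta> > 0\<close> by (auto simp: \<eta>'_def)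
  obtain \<delta>1 where \<delta>1: "0 < \<delta>1" "\<delta>1 < 1/2"
    "\<forall>\<^sub>F n in sequentially. (\<Sum>k | real k < \<delta>1 * real n. a k) \<le> \<eta>' * real n * a n"
    by (rule slowly_varying_initial_sum[OF a \<eta>'(1)])
  define \<delta> where "\<delta> = min \<delta>1 \<eta>'"
  have \<delta>: "0 < \<delta>" "\<delta> < 1/2" "\<delta> \<le> \<eta>'" "\<delta> \<le> \<delta>1" using \<delta>1 \<eta>' by (auto simp: \<delta>_def)
  have l: "ln (1 + \<eta>') / 2 > 0" using \<eta>' by simp
  have pos: "\<forall>\<^sub>F n in sequentially. a n > 0" "\<forall>\<^sub>F n in sequentially. b n > 0"
    using a b by (auto simp: slowly_varying_def regularly_varying_index_def)
  have e1: "\<forall>\<^sub>F n in sequentially. real n * \<eta>' \<ge> 1"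
    using filterlim_tendsto_pos_mult_at_top[OF tendsto_const \<eta>'(1) filterlim_real_sequentially]
    by (simp add: filterlim_at_top mult.commute)
  have h: "0 < (1/2::real)" "(1/2::real) \<le> 1" and "\<delta> \<le> 1" using \<delta> by auto
  from pos e1 \<delta>1(3) slowly_varying_uniform_below[OF a \<delta>(1) \<open>\<delta> \<le> 1\<close> l]
    slowly_varying_uniform_below[OF b h l] eventually_ge_at_top[of 1]
  show ?thesis
  proof eventually_elim
    case (elim n)
    have an: "a n > 0" "b n > 0" "real n > 0" using elim by auto
    define S1 where "S1 = {k. real k < \<delta> * real n}"
    define S2 where "S2 = {k. 2 * k \<le> n \<and> \<delta> * real n \<le> real k}"
    have "S1 \<subseteq> {..n}" "S2 \<subseteq> {..n}"
    proof -
      have "\<delta> * real n \<le> 1 * real n" using \<delta> by (intro mult_right_mono) auto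
      then show "S1 \<subseteq> {..n}" "S2 \<subseteq> {..n}" by (auto simp: S1_def S2_def)
    qed
    then have fin: "finite S1" "finite S2" by (auto intro: finite_subset)
    have sub: "{k. 2 * k \<le> n} = S1 \<union> S2" and disj: "S1 \<inter> S2 = {}"
    proof -
      have "\<delta> * real n \<le> 1/2 * real n" using \<delta> by (intro mult_right_mono) auto
      then show "{k. 2 * k \<le> n} = S1 \<union> S2" "S1 \<inter> S2 = {}"
        by (auto simp: S1_def S2_def)
    qed
    have b2: "b (n - k) > 0" "\<bar>b (n - k) - b n\<bar> \<le> \<eta>' * b n" "\<bar>ln (b (n - k)) - ln (b n)\<bar> \<le> ln (1 + \<eta>') / 2"
      if "2 * k \<le> n" for k
    proof -
      have "1/2 * real n \<le> real (n - k) \<and> n - k \<le> n" using that by linarith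
      with elim show b1: "b (n - k) > 0" and b3: "\<bar>ln (b (n - k)) - ln (b n)\<bar> \<le> ln (1 + \<eta>') / 2" by auto
      have "\<bar>ln (b (n - k)) - ln (b n)\<bar> \<le> ln (1 + \<eta>')" using b3 l by linarith
      with b1 elim \<eta>' show "\<bar>b (n - k) - b n\<bar> \<le> \<eta>' * b n" by (intro abs_diff_le_of_abs_ln_diff_le) auto
    qed
    have "(\<Sum>k\<in>S2. \<bar>a k * b (n - k) - a n * b n\<bar>) \<le> (\<Sum>k\<in>S2. \<eta>' * (a n * b n))"
    proof (rule sum_mono)
      fix k assume "k \<in> S2"
      then have k: "2 * k \<le> n" "\<delta> * real n \<le> real k" by (auto simp: S2_def)
      then have "k \<le> n" by simp
      then have ak: "a k > 0" "\<bar>ln (a k) - ln (a n)\<bar> \<le> ln (1 + \<eta>') / 2" using elim k by auto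
      have "\<bar>ln (a k * b (n - k)) - ln (a n * b n)\<bar> \<le> ln (1 + \<eta>')"
      proof -
        have "ln (a k * b (n - k)) = ln (a k) + ln (b (n - k))" "ln (a n * b n) = ln (a n) + ln (b n)"
          using ak b2(1)[OF k(1)] elim by (auto intro!: ln_mult_pos)
        with ak(2) b2(3)[OF k(1)] show ?thesis by linarith
      qed
      then show "\<bar>a k * b (n - k) - a n * b n\<bar> \<le> \<eta>' * (a n * b n)"
        using ak b2[OF k(1)] an \<eta>' by (intro abs_diff_le_of_abs_ln_diff_le) auto
    qed
    also have "\<dots> = real (card S2) * (\<eta>' * (a n * b n))" by simp
    also have "\<dots> \<le> (2 * real n) * (\<eta>' * (a n * b n))"
    proof (rule mult_right_mono)
      have "card S2 \<le> n + 1" using card_mono[OF _ \<open>S2 \<subseteq> {..n}\<close>] by simp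
      then show "real (card S2) \<le> 2 * real n" using elim by linarith
    qed (use an \<eta>' in auto)
    finally have mid: "(\<Sum>k\<in>S2. \<bar>a k * b (n - k) - a n * b n\<bar>) \<le> 2 * \<eta>' * (real n * a n * b n)"
      by (simp add: mult_ac)
    have k1: "2 * k \<le> n" if "k \<in> S1" for k using that sub by auto
    have "(\<Sum>k\<in>S1. \<bar>a k * b (n - k) - a n * b n\<bar>) \<le> (\<Sum>k\<in>S1. a k * (2 * b n) + a n * b n)"
    proof (rule sum_mono)
      fix k assume "k \<in> S1"
      have "\<eta>' * b n \<le> 1 * b n" using \<eta>' an by (intro mult_right_mono) auto
      then have "b (n - k) \<le> 2 * b n" using b2(2)[OF k1[OF \<open>k \<in> S1\<close>]] by linarith
      then have "a k * b (n - k) \<le> a k * (2 * b n)" using a0 by (intro mult_left_mono)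
      moreover have "0 \<le> a k * b (n - k)" using a0[of k] b2(1)[OF k1[OF \<open>k \<in> S1\<close>]] by simp
      moreover have "0 \<le> a n * b n" using an by simp
      ultimately show "\<bar>a k * b (n - k) - a n * b n\<bar> \<le> a k * (2 * b n) + a n * b n" by linarith
    qed
    also have "\<dots> = (\<Sum>k\<in>S1. a k) * (2 * b n) + real (card S1) * (a n * b n)"
      by (simp add: sum.distrib sum_distrib_right)
    also have "\<dots> \<le> (\<eta>' * real n * a n) * (2 * b n) + (2 * \<eta>' * real n) * (a n * b n)"
    proof (intro add_mono mult_right_mono)
      have "(\<Sum>k\<in>S1. a k) \<le> (\<Sum>k | real k < \<delta>1 * real n. a k)"
      proof (rule sum_mono2)
        have "{k. real k < \<delta>1 * real n} \<subseteq> {..n}"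
        proof -
          have "\<delta>1 * real n \<le> 1 * real n" using \<delta>1 by (intro mult_right_mono) auto
          then show ?thesis by auto
        qed
        then show "finite {k. real k < \<delta>1 * real n}" by (rule finite_subset) simp
        have "\<delta> * real n \<le> \<delta>1 * real n" using \<delta> by (intro mult_right_mono) auto
        then show "S1 \<subseteq> {k. real k < \<delta>1 * real n}" by (auto simp: S1_def)
      qed (use a0 in auto)
      also have "\<dots> \<le> \<eta>' * real n * a n" by fact
      finally show "(\<Sum>k\<in>S1. a k) \<le> \<eta>' * real n * a n" .
      define m where "m = nat \<lceil>\<delta> * real n\<rceil>"
      have m: "S1 = {..<m}" unfolding m_def S1_def by (auto, linarith+)
      have "0 \<le> \<delta> * real n" using \<delta> by simp
      then have "real m \<le> \<delta> * real n + 1" unfolding m_def by linarith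
      also have "\<dots> \<le> \<eta>' * real n + \<eta>' * real n"
        using \<delta> elim by (intro add_mono mult_right_mono) (auto simp: mult.commute)
      finally show "real (card S1) \<le> 2 * \<eta>' * real n" by (simp add: m)
    qed (use an in auto)
    finally have "(\<Sum>k\<in>S1. \<bar>a k * b (n - k) - a n * b n\<bar>) \<le> 4 * \<eta>' * (real n * a n * b n)"
      by (simp add: mult_ac)
    with mid have "(\<Sum>k\<in>S1. \<bar>a k * b (n - k) - a n * b n\<bar>) + (\<Sum>k\<in>S2. \<bar>a k * b (n - k) - a n * b n\<bar>)
        \<le> 6 * \<eta>' * (real n * a n * b n)" by (simp add: algebra_simps)
    also have "\<dots> \<le> \<eta> * (real n * a n * b n)"
      using \<eta>' an by (intro mult_right_mono) auto
    finally show ?case unfolding sub using fin disj by (simp add: sum.union_disjoint)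
  qed
qed

text \<open>
In a convolution of two slowly varying sequences each term may be replaced by a n * b n.  The
indices above n/2 are those below n/2 with a and b exchanged.
\<close>

lemma slowly_varying_conv_L1:
  assumes a: "slowly_varying a" and b: "slowly_varying b"
    and a0: "\<And>n. a n \<ge> 0" and b0: "\<And>n. b n \<ge> 0"
  shows "(\<lambda>n. (\<Sum>k\<le>n. \<bar>a k * b (n - k) - a n * b n\<bar>) / (real n * a n * b n)) \<longlonglongrightarrow> 0"
proof (rule tendstoI)
  fix \<epsilon> :: real assume "\<epsilon> > 0"
  then have e: "\<epsilon> / 4 > 0" by simp
  have pos: "\<forall>\<^sub>F n in sequentially. a n > 0" "\<forall>\<^sub>F n in sequentially. b n > 0"
    using a b by (auto simp: slowly_varying_def regularly_varying_index_def)
  from pos slowly_varying_conv_half[OF a b a0 e] slowly_varying_conv_half[OF b a b0 e] eventually_gt_at_top[of 0]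
  show "\<forall>\<^sub>F n in sequentially. dist ((\<Sum>k\<le>n. \<bar>a k * b (n - k) - a n * b n\<bar>) / (real n * a n * b n)) 0 < \<epsilon>"
  proof eventually_elim
    case (elim n)
    let ?t = "\<lambda>k. \<bar>a k * b (n - k) - a n * b n\<bar>"
    have fin: "finite {k. 2 * k \<le> n}" by (rule finite_subset[of _ "{..n}"]) auto
    have pos: "real n * a n * b n > 0" using elim by simp
    have "(\<Sum>k\<le>n. ?t k) \<le> (\<Sum>k\<in>{k. 2 * k \<le> n} \<union> (\<lambda>j. n - j) ` {j. 2 * j \<le> n}. ?t k)"
    proof (rule sum_mono2)
      show "{..n} \<subseteq> {k. 2 * k \<le> n} \<union> (\<lambda>j. n - j) ` {j. 2 * j \<le> n}"
      proof
        fix k assume "k \<in> {..n}"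
        then have "2 * k \<le> n \<or> (k = n - (n - k) \<and> 2 * (n - k) \<le> n)" by auto
        then show "k \<in> {k. 2 * k \<le> n} \<union> (\<lambda>j. n - j) ` {j. 2 * j \<le> n}" by blast
      qed
    qed (use fin in auto)
    also have "\<dots> \<le> (\<Sum>k\<in>{k. 2 * k \<le> n}. ?t k) + (\<Sum>k\<in>(\<lambda>j. n - j) ` {j. 2 * j \<le> n}. ?t k)"
    proof -
      have "(\<Sum>k\<in>{k. 2 * k \<le> n} \<inter> (\<lambda>j. n - j) ` {j. 2 * j \<le> n}. ?t k) \<ge> 0" by (rule sum_nonneg) simp
      with sum.union_inter[OF fin finite_imageI[OF fin, of "\<lambda>j. n - j"], of ?t] show ?thesis by linarith
    qed
    also have "(\<Sum>k\<in>(\<lambda>j. n - j) ` {j. 2 * j \<le> n}. ?t k) = (\<Sum>j\<in>{j. 2 * j \<le> n}. ?t (n - j))"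
      by (subst sum.reindex) (auto simp: inj_on_def)
    also have "\<dots> = (\<Sum>j\<in>{j. 2 * j \<le> n}. \<bar>b j * a (n - j) - b n * a n\<bar>)"
      by (intro sum.cong) (auto simp: mult.commute)
    also have "(\<Sum>k | 2 * k \<le> n. ?t k) + \<dots> \<le> \<epsilon>/4 * (real n * a n * b n) + \<epsilon>/4 * (real n * b n * a n)"
      using elim by (intro add_mono) auto
    also have "\<dots> = \<epsilon>/2 * (real n * a n * b n)" by simp
    finally have S: "(\<Sum>k\<le>n. ?t k) \<le> \<epsilon>/2 * (real n * a n * b n)" .
    define R where "R = (\<Sum>k\<le>n. ?t k) / (real n * a n * b n)"
    have "R \<le> \<epsilon>/2"
      using S pos unfolding R_def by (simp only: pos_divide_le_eq)
    moreover have "R \<ge> 0"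
      unfolding R_def using pos by (intro divide_nonneg_pos sum_nonneg) auto
    ultimately show ?case using \<open>\<epsilon> > 0\<close> unfolding dist_real_def R_def[symmetric] by simp
  qed
qed

text \<open>
A monotone weight w is at most w n on the range of summation, so it does not spoil the estimate in
the mean; the limit is that of the weights alone.
\<close>

lemma sum_conv_weighted_tendsto:
  assumes a: "slowly_varying a" and b: "slowly_varying b"
    and a0: "\<And>n. a n \<ge> 0" and b0: "\<And>n. b n \<ge> 0"
    and w: "mono w" "\<And>n. w n \<ge> 0" "\<forall>\<^sub>F n in sequentially. w n > 0"
    and c: "(\<lambda>n. (\<Sum>k\<le>n. w k) / (real n * w n)) \<longlonglongrightarrow> c"
  shows "(\<lambda>n. (\<Sum>k\<le>n. w k * a k * b (n - k)) / (real n * w n * a n * b n)) \<longlonglongrightarrow> c"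
proof (rule Lim_transform)
  show "(\<lambda>n. (\<Sum>k\<le>n. w k) / (real n * w n)) \<longlonglongrightarrow> c" by (rule c)
  show "(\<lambda>n. (\<Sum>k\<le>n. w k * a k * b (n - k)) / (real n * w n * a n * b n) - (\<Sum>k\<le>n. w k) / (real n * w n)) \<longlonglongrightarrow> 0"
  proof (rule Lim_null_comparison[OF _ slowly_varying_conv_L1[OF a b a0 b0]])
    have "\<forall>\<^sub>F n in sequentially. a n > 0" "\<forall>\<^sub>F n in sequentially. b n > 0"
      using a b by (auto simp: slowly_varying_def regularly_varying_index_def)
    with w(3) eventually_gt_at_top[of 0]
    show "\<forall>\<^sub>F n in sequentially. norm ((\<Sum>k\<le>n. w k * a k * b (n - k)) / (real n * w n * a n * b n) - (\<Sum>k\<le>n. w k) / (real n * w n))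
        \<le> (\<Sum>k\<le>n. \<bar>a k * b (n - k) - a n * b n\<bar>) / (real n * a n * b n)"
    proof eventually_elim
      case (elim n)
      define D where "D = real n * a n * b n"
      have D: "D > 0" using elim by (simp add: D_def)
      have "(\<Sum>k\<le>n. w k) / (real n * w n) = (\<Sum>k\<le>n. w k * (a n * b n)) / (w n * D)"
        using elim by (simp add: D_def flip: sum_distrib_right)
      moreover have "real n * w n * a n * b n = w n * D" by (simp add: D_def)
      ultimately have "(\<Sum>k\<le>n. w k * a k * b (n - k)) / (real n * w n * a n * b n) - (\<Sum>k\<le>n. w k) / (real n * w n)
          = (\<Sum>k\<le>n. w k * (a k * b (n - k) - a n * b n)) / (w n * D)"
        by (simp add: algebra_simps sum_subtractf diff_divide_distrib)
      also have "norm \<dots> \<le> (w n * (\<Sum>k\<le>n. \<bar>a k * b (n - k) - a n * b n\<bar>)) / (w n * D)"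
      proof -
        have "\<bar>\<Sum>k\<le>n. w k * (a k * b (n - k) - a n * b n)\<bar> \<le> (\<Sum>k\<le>n. \<bar>w k * (a k * b (n - k) - a n * b n)\<bar>)"
          by (rule sum_abs)
        also have "\<dots> \<le> (\<Sum>k\<le>n. w n * \<bar>a k * b (n - k) - a n * b n\<bar>)"
          unfolding abs_mult using w(2) by (intro sum_mono mult_right_mono) (auto intro: monoD[OF w(1)])
        finally have "\<bar>\<Sum>k\<le>n. w k * (a k * b (n - k) - a n * b n)\<bar>
            \<le> w n * (\<Sum>k\<le>n. \<bar>a k * b (n - k) - a n * b n\<bar>)"
          by (simp only: sum_distrib_left)
        moreover have wD: "w n * D > 0" using D elim by simp
        ultimately show ?thesis
          unfolding real_norm_def abs_divide abs_of_pos[OF wD] by (rule divide_right_mono[OF _ less_imp_le])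
      qed
      also have "\<dots> = (\<Sum>k\<le>n. \<bar>a k * b (n - k) - a n * b n\<bar>) / D" using elim by simp
      finally show ?case by (simp add: D_def)
    qed
  qed
qed

section \<open>Monotone densities\<close>

text \<open>
Monotone density theorem, for partial sums H n of T.  By monotonicity T n lies below the slope of H between n
and l n for l > 1, and above it for l < 1.  These slopes tend to difference quotients of \<phi>
at 1, after division by y n.
\<close>

lemma monotone_density:
  fixes T y :: "nat \<Rightarrow> real" and \<phi> :: "real \<Rightarrow> real"
  defines "H \<equiv> \<lambda>n. \<Sum>m\<le>n. T m"
  assumes mono: "mono T" and y: "\<forall>\<^sub>F n in sequentially. y n > 0"
    and lim: "\<And>l. l > 0 \<Longrightarrow> (\<lambda>n. H (nat \<lfloor>l * real n\<rfloor>) / (real n * y n)) \<longlonglongrightarrow> \<phi> l"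
    and deriv: "(\<phi> has_real_derivative d) (at 1)"
  shows "(\<lambda>n. T n / y n) \<longlonglongrightarrow> d"
proof -
  \<comment> \<open>The slope of H between n and l n, in units of y n.\<close>
  define Q where "Q l n = (H (nat \<lfloor>l * real n\<rfloor>) - H n) / (y n * (real (nat \<lfloor>l * real n\<rfloor>) - real n))" for l n
  have Q_lim: "Q l \<longlonglongrightarrow> (\<phi> l - \<phi> 1) / (l - 1)" if "l > 0" "l \<noteq> 1" for l
  proof -
    have "(\<lambda>n. (H (nat \<lfloor>l * real n\<rfloor>) / (real n * y n) - H (nat \<lfloor>1 * real n\<rfloor>) / (real n * y n))
        / (real (nat \<lfloor>l * real n\<rfloor>) / real n - 1)) \<longlonglongrightarrow> (\<phi> l - \<phi> 1) / (l - 1)"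
      using that by (intro tendsto_divide tendsto_diff lim nat_floor_mult_over_tendsto tendsto_const) auto
    moreover have "\<forall>\<^sub>F n in sequentially. (H (nat \<lfloor>l * real n\<rfloor>) / (real n * y n) - H (nat \<lfloor>1 * real n\<rfloor>) / (real n * y n))
        / (real (nat \<lfloor>l * real n\<rfloor>) / real n - 1) = Q l n"
      using y eventually_gt_at_top[of 0]
    proof eventually_elim
      case (elim n)
      have "real (nat \<lfloor>l * real n\<rfloor>) / real n - 1 = (real (nat \<lfloor>l * real n\<rfloor>) - real n) / real n"
        using elim by (simp add: diff_divide_distrib)
      moreover have "H (nat \<lfloor>l * real n\<rfloor>) / (real n * y n) - H (nat \<lfloor>1 * real n\<rfloor>) / (real n * y n)
          = (H (nat \<lfloor>l * real n\<rfloor>) - H n) / (y n * real n)"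
        by (simp add: diff_divide_distrib mult.commute)
      ultimately show ?case using elim by (simp add: Q_def)
    qed
    ultimately show ?thesis by (rule Lim_transform_eventually)
  qed
  have slope: "((\<lambda>l. (\<phi> l - \<phi> 1) / (l - 1)) \<longlongrightarrow> d) (at 1)"
    using deriv by (simp add: has_field_derivative_iff)
  have above: "T n / y n \<le> Q l n" if "nat \<lfloor>l * real n\<rfloor> > n" "y n > 0" for l n
  proof -
    define m where "m = nat \<lfloor>l * real n\<rfloor>"
    have mn: "m > n" using that by (simp add: m_def)
    have "H m - H n = sum T {n<..m}"
    proof -
      have "{..m} = {..n} \<union> {n<..m}" "{..n} \<inter> {n<..m} = {}" using mn by auto
      then show ?thesis unfolding H_def by (simp add: sum.union_disjoint)
    qed
    also have "\<dots> \<ge> (\<Sum>k\<in>{n<..m}. T n)" by (intro sum_mono monoD[OF mono]) auto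
    finally have "(real m - real n) * T n \<le> H m - H n" using mn by (simp add: of_nat_diff)
    then show ?thesis using mn that(2) unfolding Q_def m_def[symmetric]
      by (simp add: divide_simps mult_ac)
  qed
  have below: "Q l n \<le> T n / y n" if "nat \<lfloor>l * real n\<rfloor> < n" "y n > 0" for l n
  proof -
    define m where "m = nat \<lfloor>l * real n\<rfloor>"
    have mn: "m < n" using that by (simp add: m_def)
    have "H n - H m = sum T {m<..n}"
    proof -
      have "{..n} = {..m} \<union> {m<..n}" "{..m} \<inter> {m<..n} = {}" using mn by auto
      then show ?thesis unfolding H_def by (simp add: sum.union_disjoint)
    qed
    also have "\<dots> \<le> (\<Sum>k\<in>{m<..n}. T n)" by (intro sum_mono monoD[OF mono]) auto
    finally have le: "H n - H m \<le> (real n - real m) * T n" using mn by (simp add: of_nat_diff)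
    have "Q l n = (H n - H m) / (y n * (real n - real m))"
      unfolding Q_def m_def[symmetric] by (metis minus_diff_eq minus_divide_divide mult_minus_right)
    also have "\<dots> \<le> ((real n - real m) * T n) / (y n * (real n - real m))"
      using le mn that by (intro divide_right_mono) auto
    also have "\<dots> = T n / y n" using mn by simp
    finally show ?thesis .
  qed
  have index: "\<forall>\<^sub>F n in sequentially. real (nat \<lfloor>l * real n\<rfloor>) / real n \<in> U"
    if "l > 0" "open U" "l \<in> U" for l U
    by (rule topological_tendstoD[OF nat_floor_mult_over_tendsto]) fact+
  show ?thesis
  proof (rule order_tendstoI)
    fix u assume "d < u"
    have "\<forall>\<^sub>F l in at_right 1. (\<phi> l - \<phi> 1) / (l - 1) < u"
      using filterlim_mono[OF slope order_refl, of "at_right 1"] \<open>d < u\<close>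
      by (intro order_tendstoD(2)) (auto simp: at_within_le_at)
    then obtain l where l: "l > 1" "(\<phi> l - \<phi> 1) / (l - 1) < u"
      using eventually_happens'[OF trivial_limit_at_right_real] eventually_at_right_less
      by (metis (no_types, lifting) eventually_conj)
    have "\<forall>\<^sub>F n in sequentially. Q l n < u"
      using Q_lim[of l] l by (intro order_tendstoD(2)) auto
    moreover have "\<forall>\<^sub>F n in sequentially. real (nat \<lfloor>l * real n\<rfloor>) / real n \<in> {1<..}"
      using l by (intro index) auto
    ultimately show "\<forall>\<^sub>F n in sequentially. T n / y n < u"
      using y eventually_gt_at_top[of 0]
    proof eventually_elim
      case (elim n)
      then have "nat \<lfloor>l * real n\<rfloor> > n" by (simp add: field_simps)
      from above[OF this] elim show ?case by simp
    qed
  next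
    fix u assume "u < d"
    have "\<forall>\<^sub>F l in at_left 1. u < (\<phi> l - \<phi> 1) / (l - 1)"
      using filterlim_mono[OF slope order_refl, of "at_left 1"] \<open>u < d\<close>
      by (intro order_tendstoD(1)) (auto simp: at_within_le_at)
    moreover have "\<forall>\<^sub>F l in at_left (1::real). l \<in> {0<..<1}"
      by (rule eventually_at_leftI[of 0]) auto
    ultimately have "\<forall>\<^sub>F l in at_left 1. u < (\<phi> l - \<phi> 1) / (l - 1) \<and> l \<in> {0<..<1}"
      by (rule eventually_conj)
    then obtain l where "u < (\<phi> l - \<phi> 1) / (l - 1) \<and> l \<in> {0<..<1}"
      using eventually_happens'[OF trivial_limit_at_left_real] by blast
    then have l: "0 < l" "l < 1" "u < (\<phi> l - \<phi> 1) / (l - 1)" by auto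
    have "\<forall>\<^sub>F n in sequentially. u < Q l n"
      using Q_lim[of l] l by (intro order_tendstoD(1)) auto
    moreover have "\<forall>\<^sub>F n in sequentially. real (nat \<lfloor>l * real n\<rfloor>) / real n \<in> {..<1}"
      using l by (intro index) auto
    ultimately show "\<forall>\<^sub>F n in sequentially. u < T n / y n"
      using y eventually_gt_at_top[of 0]
    proof eventually_elim
      case (elim n)
      then have "nat \<lfloor>l * real n\<rfloor> < n" by (simp add: field_simps)
      from below[OF this] elim show ?case by simp
    qed
  qed
qed

section \<open>Averages over short windows\<close>

definition window_average :: "(nat \<Rightarrow> real) \<Rightarrow> real \<Rightarrow> nat \<Rightarrow> real" where
  "window_average f \<epsilon> n = 1 / (\<epsilon> * real n) * (\<Sum>k | (1 - \<epsilon>) * real n < real k \<and> k \<le> n. f k)"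

text \<open>
The order of quantifiers matters: the window has a fixed relative length \<epsilon> while n tends to infinity, and the error
vanishes only as \<epsilon> tends to 0.
\<close>

definition window_equiv :: "(nat \<Rightarrow> real) \<Rightarrow> (nat \<Rightarrow> real) \<Rightarrow> bool" where
  "window_equiv f v \<longleftrightarrow> (\<forall>\<eta>>0. \<exists>\<epsilon>0>0. \<forall>\<epsilon>. 0 < \<epsilon> \<and> \<epsilon> < \<epsilon>0 \<longrightarrow>
     (\<forall>\<^sub>F n in sequentially. \<bar>window_average f \<epsilon> n - v n\<bar> \<le> \<eta> * v n))"

lemma window_eq:
  assumes "0 < \<epsilon>" "\<epsilon> < 1"
  shows "{k. (1 - \<epsilon>) * real n < real k \<and> k \<le> n} = {nat \<lfloor>(1 - \<epsilon>) * real n\<rfloor><..n}"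
    and "nat \<lfloor>(1 - \<epsilon>) * real n\<rfloor> \<le> n"
    and "\<epsilon> * real n \<le> real (card {k. (1 - \<epsilon>) * real n < real k \<and> k \<le> n})"
    and "real (card {k. (1 - \<epsilon>) * real n < real k \<and> k \<le> n}) \<le> \<epsilon> * real n + 1"
proof -
  have nn: "0 \<le> (1 - \<epsilon>) * real n" using assms by simp
  have le: "(1 - \<epsilon>) * real n \<le> real n" using assms by (simp add: mult_left_le_one_le)
  show eq: "{k. (1 - \<epsilon>) * real n < real k \<and> k \<le> n} = {nat \<lfloor>(1 - \<epsilon>) * real n\<rfloor><..n}"
    using nn by (auto, linarith+)
  show m: "nat \<lfloor>(1 - \<epsilon>) * real n\<rfloor> \<le> n" using le by linarith
  have *: "(1 - \<epsilon>) * real n - 1 \<le> real (nat \<lfloor>(1 - \<epsilon>) * real n\<rfloor>)"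
    "real (nat \<lfloor>(1 - \<epsilon>) * real n\<rfloor>) \<le> (1 - \<epsilon>) * real n"
    using nn by linarith+
  have "(1 - \<epsilon>) * real n = real n - \<epsilon> * real n" by (simp add: algebra_simps)
  with * show "\<epsilon> * real n \<le> real (card {k. (1 - \<epsilon>) * real n < real k \<and> k \<le> n})"
    "real (card {k. (1 - \<epsilon>) * real n < real k \<and> k \<le> n}) \<le> \<epsilon> * real n + 1"
    unfolding eq card_greaterThanAtMost of_nat_diff[OF m] by linarith+
qed

text \<open>
By uniform convergence v k / v n is close to (k/n)^\<rho>, and k/n is close to 1 in a short window.
\<close>

lemma window_equiv_refl:
  assumes rv: "regularly_varying_index v \<rho>"
  shows "window_equiv v v"
  unfolding window_equiv_def
proof (intro allI impI)
  fix \<eta> :: real assume "\<eta> > 0"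
  define \<kappa> where "\<kappa> = min 1 (\<eta> / 3)"
  have \<kappa>: "\<kappa> > 0" "\<kappa> \<le> 1" "3 * \<kappa> \<le> \<eta>" using \<open>\<eta> > 0\<close> by (auto simp: \<kappa>_def)
  \<comment> \<open>For k/n > exp (-t) the power (k/n)^\<rho> contributes at most half of ln (1 + \<kappa>).\<close>
  define t where "t = ln (1 + \<kappa>) / 2 / (\<bar>\<rho>\<bar> + 1)"
  have l: "ln (1 + \<kappa>) / 2 > 0" using \<kappa> by simp
  have t: "t > 0" unfolding t_def using l by (intro divide_pos_pos) auto
  have \<rho>t: "\<bar>\<rho>\<bar> * t \<le> ln (1 + \<kappa>) / 2"
  proof -
    have "\<bar>\<rho>\<bar> * t \<le> (\<bar>\<rho>\<bar> + 1) * t" using t by (intro mult_right_mono) auto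
    moreover have "\<bar>\<rho>\<bar> + 1 \<noteq> 0" by linarith
    then have "(\<bar>\<rho>\<bar> + 1) * t = ln (1 + \<kappa>) / 2"
      unfolding t_def by (metis nonzero_mult_div_cancel_left times_divide_eq_right)
    ultimately show ?thesis by linarith
  qed
  define \<epsilon>0 where "\<epsilon>0 = min (1/2) (1 - exp (- t))"
  have "\<epsilon>0 > 0" using t by (simp add: \<epsilon>0_def)
  moreover have "\<forall>\<^sub>F n in sequentially. \<bar>window_average v \<epsilon> n - v n\<bar> \<le> \<eta> * v n" if "0 < \<epsilon> \<and> \<epsilon> < \<epsilon>0" for \<epsilon>
  proof -
    have \<epsilon>: "0 < \<epsilon>" "\<epsilon> < 1/2" "exp (- t) < 1 - \<epsilon>" using that by (auto simp: \<epsilon>0_def)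
    have pos: "\<forall>\<^sub>F n in sequentially. v n > 0"
      using rv by (auto simp: regularly_varying_index_def)
    have "\<kappa> * \<epsilon> > 0" using \<kappa> \<epsilon> by simp
    then have ev: "\<forall>\<^sub>F n in sequentially. \<kappa> * \<epsilon> * real n \<ge> 1"
      using filterlim_tendsto_pos_mult_at_top[OF tendsto_const _ filterlim_real_sequentially]
      by (simp add: filterlim_at_top)
    have h: "0 < 1 - \<epsilon>" "1 - \<epsilon> \<le> 1" using \<epsilon> by auto
    from pos ev eventually_gt_at_top[of 0] regularly_varying_uniform_below[OF rv h l]
    show ?thesis
    proof eventually_elim
      case (elim n)
      note vn = \<open>v n > 0\<close>
      define W where "W = {k. (1 - \<epsilon>) * real n < real k \<and> k \<le> n}"
      have \<epsilon>1: "\<epsilon> < 1" using \<epsilon> by simp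
      note c = window_eq(3,4)[OF \<epsilon>(1) \<epsilon>1, of n, folded W_def]
      have close: "\<bar>v k - v n\<bar> \<le> \<kappa> * v n" if "k \<in> W" for k
      proof -
        have k: "(1 - \<epsilon>) * real n < real k" "k \<le> n" using that by (auto simp: W_def)
        with elim have vk: "v k > 0" "\<bar>ln (v k) - ln (v n) - \<rho> * ln (real k / real n)\<bar> \<le> ln (1 + \<kappa>) / 2"
          by auto
        have "exp (- t) \<le> real k / real n" using k elim \<epsilon>(3)
          by (simp add: pos_le_divide_eq) (smt (verit) mult_right_mono of_nat_0_le_iff)
        moreover have "real k / real n > 0" using calculation by (smt (verit) exp_gt_zero)
        moreover have "real k / real n \<le> 1" using k elim by (simp add: divide_le_eq)
        ultimately have "\<bar>ln (real k / real n)\<bar> \<le> t"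
          by (smt (verit) exp_gt_zero ln_exp ln_le_cancel_iff ln_le_zero_iff)
        then have "\<bar>\<rho> * ln (real k / real n)\<bar> \<le> \<bar>\<rho>\<bar> * t"
          unfolding abs_mult by (intro mult_left_mono) auto
        then have "\<bar>ln (v k) - ln (v n)\<bar> \<le> ln (1 + \<kappa>)" using vk \<rho>t by linarith
        then show ?thesis using vk vn \<kappa> by (intro abs_diff_le_of_abs_ln_diff_le) auto
      qed
      have en: "\<epsilon> * real n > 0" using \<epsilon> elim by simp
      have "\<bar>sum v W - real (card W) * v n\<bar> = \<bar>\<Sum>k\<in>W. v k - v n\<bar>" by (simp add: sum_subtractf)
      also have "\<dots> \<le> (\<Sum>k\<in>W. \<bar>v k - v n\<bar>)" by (rule sum_abs)
      also have "\<dots> \<le> (\<Sum>k\<in>W. \<kappa> * v n)" by (intro sum_mono close)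
      finally have 1: "\<bar>sum v W - real (card W) * v n\<bar> \<le> real (card W) * (\<kappa> * v n)" by simp
      have card: "real (card W) \<le> (1 + \<kappa>) * (\<epsilon> * real n)" using c(2) elim by (simp add: algebra_simps)
      have "real (card W) * (\<kappa> * v n) \<le> (2 * (\<epsilon> * real n)) * (\<kappa> * v n)"
      proof (rule mult_right_mono)
        have "(1 + \<kappa>) * (\<epsilon> * real n) \<le> 2 * (\<epsilon> * real n)" using \<kappa> en by (intro mult_right_mono) auto
        then show "real (card W) \<le> 2 * (\<epsilon> * real n)" using card by linarith
      qed (use \<kappa> vn in auto)
      moreover have "\<bar>real (card W) * v n - \<epsilon> * real n * v n\<bar> \<le> \<kappa> * (\<epsilon> * real n) * v n"
      proof -
        have "\<bar>real (card W) - \<epsilon> * real n\<bar> \<le> \<kappa> * (\<epsilon> * real n)" using card c(1) by (simp add: algebra_simps)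
        then have "\<bar>real (card W) - \<epsilon> * real n\<bar> * v n \<le> \<kappa> * (\<epsilon> * real n) * v n"
          using vn by (intro mult_right_mono) auto
        moreover have "\<bar>real (card W) * v n - \<epsilon> * real n * v n\<bar> = \<bar>real (card W) - \<epsilon> * real n\<bar> * v n"
          using vn by (simp add: abs_mult flip: left_diff_distrib)
        ultimately show ?thesis by simp
      qed
      ultimately have "\<bar>sum v W - \<epsilon> * real n * v n\<bar> \<le> (2 * (\<epsilon> * real n)) * (\<kappa> * v n) + \<kappa> * (\<epsilon> * real n) * v n"
        using 1 by linarith
      also have "\<dots> = (3 * \<kappa>) * (\<epsilon> * real n * v n)" by simp
      also have "\<dots> \<le> \<eta> * (\<epsilon> * real n * v n)" using \<kappa> en vn by (intro mult_right_mono) auto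
      finally have "\<bar>sum v W - \<epsilon> * real n * v n\<bar> \<le> \<eta> * (\<epsilon> * real n * v n)" .
      moreover define x where "x = \<epsilon> * real n"
      ultimately have le: "\<bar>sum v W - x * v n\<bar> \<le> (\<eta> * v n) * x" and x: "x > 0"
        using en by (simp_all add: mult_ac)
      have "window_average v \<epsilon> n - v n = (sum v W - x * v n) / x"
        using x unfolding window_average_def W_def[symmetric] x_def[symmetric] by (simp add: diff_divide_distrib)
      then have "\<bar>window_average v \<epsilon> n - v n\<bar> = \<bar>sum v W - x * v n\<bar> / x" using x by (simp add: abs_divide)
      also have "\<dots> \<le> \<eta> * v n" using le x by (simp only: pos_divide_le_eq)
      finally show ?case .
    qed
  qed
  ultimately show "\<exists>\<epsilon>0>0. \<forall>\<epsilon>. 0 < \<epsilon> \<and> \<epsilon> < \<epsilon>0 \<longrightarrow>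
      (\<forall>\<^sub>F n in sequentially. \<bar>window_average v \<epsilon> n - v n\<bar> \<le> \<eta> * v n)" by blast
qed

lemma asymp_equiv_eventually_close:
  fixes v w :: "nat \<Rightarrow> real"
  assumes "v \<sim>[sequentially] w" "\<forall>\<^sub>F n in sequentially. w n > 0" "\<eta> > 0"
  shows "\<forall>\<^sub>F n in sequentially. \<bar>v n - w n\<bar> \<le> \<eta> * w n"
proof -
  have "\<forall>\<^sub>F n in sequentially. dist (if v n = 0 \<and> w n = 0 then 1 else v n / w n) 1 < \<eta>"
    using asymp_equivD[OF assms(1)] assms(3) by (rule tendstoD)
  with assms(2) show ?thesis
  proof eventually_elim
    case (elim n)
    then have "\<bar>(v n - w n) / w n\<bar> < \<eta>" by (simp add: dist_real_def diff_divide_distrib)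
    then show ?case using elim by (simp add: field_simps)
  qed
qed

lemma asymp_equivI_close:
  fixes v w :: "nat \<Rightarrow> real"
  assumes w: "\<forall>\<^sub>F n in sequentially. w n > 0"
    and close: "\<And>\<eta>. 0 < \<eta> \<Longrightarrow> \<forall>\<^sub>F n in sequentially. \<bar>v n - w n\<bar> \<le> \<eta> * w n"
  shows "v \<sim>[sequentially] w"
proof (rule asymp_equivI', rule tendstoI)
  fix e :: real assume "e > 0"
  show "\<forall>\<^sub>F n in sequentially. dist (v n / w n) 1 < e"
  proof -
    have "\<forall>\<^sub>F n in sequentially. \<bar>v n - w n\<bar> \<le> e / 2 * w n" using close[of "e / 2"] \<open>e > 0\<close> by simp
    with w show ?thesis
    proof eventually_elim
      case (elim n)
      then have "\<bar>(v n - w n) / w n\<bar> \<le> e / 2" by (simp add: field_simps)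
      moreover have "(v n - w n) / w n = v n / w n - 1" using elim by (simp add: diff_divide_distrib)
      ultimately have "\<bar>v n / w n - 1\<bar> \<le> e / 2" by (simp only:)
      then show ?case using \<open>e > 0\<close> unfolding dist_real_def by linarith
    qed
  qed
qed

lemma window_equiv_asymp_equiv_trans:
  assumes win: "window_equiv f v" and vw: "v \<sim>[sequentially] w" and w: "\<forall>\<^sub>F n in sequentially. w n > 0"
  shows "window_equiv f w"
  unfolding window_equiv_def
proof (intro allI impI)
  fix \<eta> :: real assume "\<eta> > 0"
  define \<kappa> where "\<kappa> = min 1 (\<eta> / 3)"
  have \<kappa>: "\<kappa> > 0" "\<kappa> \<le> 1" "3 * \<kappa> \<le> \<eta>" using \<open>\<eta> > 0\<close> by (auto simp: \<kappa>_def)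
  obtain \<epsilon>0 where \<epsilon>0: "\<epsilon>0 > 0" "\<And>\<epsilon>. 0 < \<epsilon> \<Longrightarrow> \<epsilon> < \<epsilon>0 \<Longrightarrow>
      \<forall>\<^sub>F n in sequentially. \<bar>window_average f \<epsilon> n - v n\<bar> \<le> \<kappa> * v n"
    using win \<kappa>(1) unfolding window_equiv_def by blast
  have "\<forall>\<^sub>F n in sequentially. \<bar>window_average f \<epsilon> n - w n\<bar> \<le> \<eta> * w n" if "0 < \<epsilon> \<and> \<epsilon> < \<epsilon>0" for \<epsilon>
  proof -
    have "\<forall>\<^sub>F n in sequentially. \<bar>window_average f \<epsilon> n - v n\<bar> \<le> \<kappa> * v n" using \<epsilon>0(2) that by blast
    with asymp_equiv_eventually_close[OF vw w \<kappa>(1)] w show ?thesis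
    proof eventually_elim
      case (elim n)
      have kw: "\<kappa> * w n \<le> 1 * w n" using \<kappa> elim by (intro mult_right_mono) auto
      then have "v n \<le> 2 * w n" using elim by linarith
      then have "\<kappa> * v n \<le> \<kappa> * (2 * w n)" using \<kappa> by (intro mult_left_mono) auto
      then have "\<bar>window_average f \<epsilon> n - w n\<bar> \<le> (3 * \<kappa>) * w n" using elim by linarith
      also have "\<dots> \<le> \<eta> * w n" using \<kappa> elim by (intro mult_right_mono) auto
      finally show ?case .
    qed
  qed
  with \<epsilon>0(1) show "\<exists>\<epsilon>0>0. \<forall>\<epsilon>. 0 < \<epsilon> \<and> \<epsilon> < \<epsilon>0 \<longrightarrow>
      (\<forall>\<^sub>F n in sequentially. \<bar>window_average f \<epsilon> n - w n\<bar> \<le> \<eta> * w n)" by blast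
qed

text \<open>
For a common small window both sequences are close to the same average.
\<close>

lemma window_equiv_unique:
  assumes v: "window_equiv f v" "\<forall>\<^sub>F n in sequentially. v n > 0"
    and w: "window_equiv f w" "\<forall>\<^sub>F n in sequentially. w n > 0"
  shows "v \<sim>[sequentially] w"
proof (rule asymp_equivI_close[OF w(2)])
  fix \<eta> :: real assume "\<eta> > 0"
  define \<kappa> where "\<kappa> = min (1/2) (\<eta> / 4)"
  have \<kappa>: "\<kappa> > 0" "\<kappa> \<le> 1/2" "4 * \<kappa> \<le> \<eta>" using \<open>\<eta> > 0\<close> by (auto simp: \<kappa>_def)
  obtain \<epsilon>1 where \<epsilon>1: "\<epsilon>1 > 0" "\<And>\<epsilon>. 0 < \<epsilon> \<Longrightarrow> \<epsilon> < \<epsilon>1 \<Longrightarrow>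
      \<forall>\<^sub>F n in sequentially. \<bar>window_average f \<epsilon> n - v n\<bar> \<le> \<kappa> * v n"
    using v(1) \<kappa>(1) unfolding window_equiv_def by blast
  obtain \<epsilon>2 where \<epsilon>2: "\<epsilon>2 > 0" "\<And>\<epsilon>. 0 < \<epsilon> \<Longrightarrow> \<epsilon> < \<epsilon>2 \<Longrightarrow>
      \<forall>\<^sub>F n in sequentially. \<bar>window_average f \<epsilon> n - w n\<bar> \<le> \<kappa> * w n"
    using w(1) \<kappa>(1) unfolding window_equiv_def by blast
  define \<epsilon> where "\<epsilon> = min \<epsilon>1 \<epsilon>2 / 2"
  have \<epsilon>: "0 < \<epsilon>" "\<epsilon> < \<epsilon>1" "\<epsilon> < \<epsilon>2" using \<epsilon>1(1) \<epsilon>2(1) by (auto simp: \<epsilon>_def)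
  from \<epsilon>1(2)[OF \<epsilon>(1,2)] \<epsilon>2(2)[OF \<epsilon>(1,3)] v(2) w(2)
  show "\<forall>\<^sub>F n in sequentially. \<bar>v n - w n\<bar> \<le> \<eta> * w n"
  proof eventually_elim
    case (elim n)
    have h: "\<kappa> * v n \<le> 1/2 * v n" "\<kappa> * w n \<le> 1/2 * w n" using \<kappa> elim by (auto intro!: mult_right_mono)
    then have "v n \<le> 3 * w n" using elim by linarith
    then have "\<kappa> * v n \<le> \<kappa> * (3 * w n)" using \<kappa> by (intro mult_left_mono) auto
    then have "\<bar>v n - w n\<bar> \<le> (4 * \<kappa>) * w n" using elim by linarith
    also have "\<dots> \<le> \<eta> * w n" using \<kappa> elim by (intro mult_right_mono) auto
    finally show ?case .
  qed
qed

lemma window_equiv_of_asymp_equiv: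
  assumes v: "regularly_varying_index v \<rho>" and fv: "f \<sim>[sequentially] v"
  shows "window_equiv f v"
proof (rule window_equiv_asymp_equiv_trans[OF _ fv])
  show "window_equiv f f"
    by (rule window_equiv_refl[OF regularly_varying_index_asymp_equiv[OF v fv]])
  show "\<forall>\<^sub>F n in sequentially. v n > 0" using v by (auto simp: regularly_varying_index_def)
qed

text \<open>
J n is the largest j \<le> n whose threshold has been passed by n.
\<close>

lemma eventually_diagonal:
  fixes P :: "nat \<Rightarrow> nat \<Rightarrow> bool"
  assumes "\<And>j. \<forall>\<^sub>F n in sequentially. P j n"
  obtains J where "filterlim J at_top sequentially" "\<forall>\<^sub>F n in sequentially. P (J n) n"
proof -
  obtain N where N: "\<And>j n. n \<ge> N j \<Longrightarrow> P j n"
    using assms unfolding eventually_sequentially by metis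
  define J where "J n = (if N 0 \<le> n then Max {j. j \<le> n \<and> N j \<le> n} else 0)" for n
  have fin: "finite {j. j \<le> n \<and> N j \<le> n}" for n by auto
  have mem: "P (J n) n" if "N 0 \<le> n" for n
  proof -
    have "Max {j. j \<le> n \<and> N j \<le> n} \<in> {j. j \<le> n \<and> N j \<le> n}"
      using that by (intro Max_in fin) auto
    then show ?thesis using N that by (simp add: J_def)
  qed
  have ge: "J n \<ge> j" if "n \<ge> max (N 0) (max j (N j))" for j n
    using that by (auto simp: J_def intro!: Max_ge fin)
  show ?thesis
  proof (rule that)
    show "filterlim J at_top sequentially"
      unfolding filterlim_at_top eventually_sequentially using ge by blast
    show "\<forall>\<^sub>F n in sequentially. P (J n) n"
      unfolding eventually_sequentially using mem by blast
  qed
qed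

lemma window_equiv_diagonal:
  assumes win: "window_equiv f v" and v: "\<forall>\<^sub>F n in sequentially. v n > 0"
  obtains \<epsilon> where "\<And>n. \<epsilon> n > 0" "\<epsilon> \<longlonglongrightarrow> 0"
    "(\<lambda>n. window_average f (\<epsilon> n) n) \<sim>[sequentially] v"
proof -
  have "\<exists>e. 0 < e \<and> e < 1 / real (Suc j) \<and>
      (\<forall>\<^sub>F n in sequentially. \<bar>window_average f e n - v n\<bar> \<le> 1 / real (Suc j) * v n)" for j
  proof -
    obtain \<epsilon>0 where \<epsilon>0: "\<epsilon>0 > 0" "\<And>\<epsilon>. 0 < \<epsilon> \<and> \<epsilon> < \<epsilon>0 \<Longrightarrow>
        \<forall>\<^sub>F n in sequentially. \<bar>window_average f \<epsilon> n - v n\<bar> \<le> 1 / real (Suc j) * v n"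
    proof -
      have "1 / real (Suc j) > 0" by simp
      with win show ?thesis using that unfolding window_equiv_def by blast
    qed
    have "0 < min \<epsilon>0 (1 / real (Suc j)) / 2" "min \<epsilon>0 (1 / real (Suc j)) / 2 < \<epsilon>0"
      "min \<epsilon>0 (1 / real (Suc j)) / 2 < 1 / real (Suc j)"
      using \<epsilon>0(1) by (auto simp: min_def field_simps)
    then show ?thesis using \<epsilon>0(2) by blast
  qed
  then obtain e where e: "\<And>j. 0 < e j" "\<And>j. e j < 1 / real (Suc j)"
      "\<And>j. \<forall>\<^sub>F n in sequentially. \<bar>window_average f (e j) n - v n\<bar> \<le> 1 / real (Suc j) * v n"
    by metis
  obtain J where J: "filterlim J at_top sequentially"
    "\<forall>\<^sub>F n in sequentially. \<bar>window_average f (e (J n)) n - v n\<bar> \<le> 1 / real (Suc (J n)) * v n"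
    using eventually_diagonal[of "\<lambda>j n. \<bar>window_average f (e j) n - v n\<bar> \<le> 1 / real (Suc j) * v n", OF e(3)] by blast
  have J0: "(\<lambda>n. 1 / real (Suc (J n))) \<longlonglongrightarrow> 0"
    using filterlim_compose[OF LIMSEQ_Suc[OF lim_1_over_n] J(1)] by simp
  show ?thesis
  proof (rule that[of "\<lambda>n. e (J n)"])
    show "e (J n) > 0" for n by (rule e)
    show "(\<lambda>n. e (J n)) \<longlonglongrightarrow> 0"
      by (rule tendsto_sandwich[OF _ _ tendsto_const J0]) (intro always_eventually allI less_imp_le e)+
    show "(\<lambda>n. window_average f (e (J n)) n) \<sim>[sequentially] v"
    proof (rule asymp_equivI_close[OF v])
      fix \<eta> :: real assume "\<eta> > 0"
      have "\<forall>\<^sub>F n in sequentially. 1 / real (Suc (J n)) < \<eta>" using J0 \<open>\<eta> > 0\<close> by (rule order_tendstoD)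
      with J(2) v show "\<forall>\<^sub>F n in sequentially. \<bar>window_average f (e (J n)) n - v n\<bar> \<le> \<eta> * v n"
      proof eventually_elim
        case (elim n)
        have "1 / real (Suc (J n)) * v n \<le> \<eta> * v n" using elim by (intro mult_right_mono) auto
        then show ?case using elim by linarith
      qed
    qed
  qed
qed

text \<open>
The partial sums of k f k are equivalent to n^2 v n, and their increment over the window
((1 - \<epsilon>) n, n] is therefore equivalent to \<epsilon> n^2 v n.  In the window the
weight k lies between (1 - \<epsilon>) n and n.
\<close>

lemma window_equiv_of_weighted_sum:
  assumes f: "\<And>n. f n \<ge> 0" and q: "slowly_varying (\<lambda>n. real n * v n)"
    and T: "(\<lambda>n. (\<Sum>k\<le>n. real k * f k) / (real n * (real n * v n))) \<longlonglongrightarrow> 1"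
  shows "window_equiv f v"
  unfolding window_equiv_def
proof (intro allI impI)
  fix \<eta> :: real assume "\<eta> > 0"
  define \<kappa> where "\<kappa> = min 1 \<eta>"
  have \<kappa>: "\<kappa> > 0" "\<kappa> \<le> 1" "\<kappa> \<le> \<eta>" using \<open>\<eta> > 0\<close> by (auto simp: \<kappa>_def)
  define T where "T n = (\<Sum>k\<le>n. real k * f k)" for n
  define q where "q n = real n * v n" for n
  have "\<forall>\<^sub>F n in sequentially. \<bar>window_average f \<epsilon> n - v n\<bar> \<le> \<eta> * v n" if "0 < \<epsilon> \<and> \<epsilon> < \<kappa> / 8" for \<epsilon>
  proof -
    have \<epsilon>: "0 < \<epsilon>" "\<epsilon> < 1" "8 * \<epsilon> \<le> \<kappa>" using that \<kappa> by auto
    define m where "m n = nat \<lfloor>(1 - \<epsilon>) * real n\<rfloor>" for n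
    have l: "1 - \<epsilon> > 0" using \<epsilon> by simp
    have m_lim: "filterlim m sequentially sequentially"
      unfolding m_def by (rule filterlim_nat_floor_mult[OF l])
    have pos: "\<forall>\<^sub>F n in sequentially. q n > 0" and qlim: "(\<lambda>n. q (m n) / q n) \<longlonglongrightarrow> 1"
      using assms(2) l by (auto simp: slowly_varying_def regularly_varying_index_def q_def m_def)
    have T1: "(\<lambda>n. T n / (real n * q n)) \<longlonglongrightarrow> 1" using assms(3) by (simp add: T_def q_def)
    have "(\<lambda>n. T n / (real n * q n) - T (m n) / (real (m n) * q (m n)) * (real (m n) / real n) * (q (m n) / q n))
        \<longlonglongrightarrow> 1 - 1 * (1 - \<epsilon>) * 1"
      using nat_floor_mult_over_tendsto[OF l] filterlim_compose[OF T1 m_lim]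
      by (intro tendsto_diff tendsto_mult qlim T1) (auto simp: m_def)
    moreover have "\<forall>\<^sub>F n in sequentially. T n / (real n * q n) -
        T (m n) / (real (m n) * q (m n)) * (real (m n) / real n) * (q (m n) / q n) = (T n - T (m n)) / (real n * q n)"
      using pos m_lim[unfolded filterlim_iff, rule_format, OF pos] m_lim[unfolded filterlim_iff, rule_format, OF eventually_gt_at_top[of 0]]
      by eventually_elim (simp add: diff_divide_distrib)
    ultimately have "(\<lambda>n. (T n - T (m n)) / (real n * q n)) \<longlonglongrightarrow> \<epsilon>"
      by (simp add: Lim_transform_eventually)
    then have "(\<lambda>n. (T n - T (m n)) / (real n * q n) / \<epsilon>) \<longlonglongrightarrow> \<epsilon> / \<epsilon>"
      using \<epsilon> by (intro tendsto_divide tendsto_const) auto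
    then have lim: "(\<lambda>n. (T n - T (m n)) / (real n * q n) / \<epsilon>) \<longlonglongrightarrow> 1" using \<epsilon> by simp
    have e1: "\<forall>\<^sub>F n in sequentially. (T n - T (m n)) / (real n * q n) / \<epsilon> < 1 + \<kappa>/4"
      "\<forall>\<^sub>F n in sequentially. (T n - T (m n)) / (real n * q n) / \<epsilon> > 1 - \<kappa>/4"
      using \<kappa> by (intro order_tendstoD[OF lim]; simp)+
    from e1 pos eventually_gt_at_top[of 0] show ?thesis
    proof eventually_elim
      case (elim n)
      define W where "W = {k. (1 - \<epsilon>) * real n < real k \<and> k \<le> n}"
      note W = window_eq(1,2)[OF \<epsilon>(1,2), of n, folded W_def m_def]
      have v: "v n > 0" using elim by (simp add: q_def zero_less_mult_iff)
      have "T n - T (m n) = (\<Sum>k\<in>W. real k * f k)"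
      proof -
        have "{..n} = {..m n} \<union> W" "{..m n} \<inter> W = {}" using W by auto
        then show ?thesis unfolding T_def using W by (simp add: sum.union_disjoint)
      qed
      moreover have "(\<Sum>k\<in>W. real k * f k) \<le> real n * sum f W"
        unfolding sum_distrib_left by (intro sum_mono mult_right_mono f) (auto simp: W_def)
      moreover have "(1 - \<epsilon>) * real n * sum f W \<le> (\<Sum>k\<in>W. real k * f k)"
        unfolding sum_distrib_left by (intro sum_mono mult_right_mono f) (auto simp: W_def)
      ultimately have D: "T n - T (m n) \<le> real n * sum f W" "(1 - \<epsilon>) * (real n * sum f W) \<le> T n - T (m n)" by simp_all
      define A where "A = window_average f \<epsilon> n"
      have nz: "real n > 0" "\<epsilon> * v n > 0" using elim \<epsilon> v by simp_all
      have A: "real n * sum f W = A * \<epsilon> * real n * real n"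
        unfolding A_def window_average_def W_def[symmetric] using elim \<epsilon> by simp
      have x: "(T n - T (m n)) / (real n * q n) / \<epsilon> = (T n - T (m n)) / (real n * real n * (\<epsilon> * v n))"
        by (simp add: q_def mult_ac)
      have dpos: "real n * real n * (\<epsilon> * v n) > 0" using nz by simp
      have up: "T n - T (m n) < (1 + \<kappa>/4) * (real n * real n * (\<epsilon> * v n))"
        using elim(1) unfolding x pos_divide_less_eq[OF dpos] .
      have lo: "(1 - \<kappa>/4) * (real n * real n * (\<epsilon> * v n)) < T n - T (m n)"
        using elim(2) unfolding x pos_less_divide_eq[OF dpos] .
      have cpos: "real n * real n * \<epsilon> > 0" using nz \<epsilon> by simp
      have "(1 - \<kappa>/4) * v n * (real n * real n * \<epsilon>) < A * (real n * real n * \<epsilon>)"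
        using lo D(1) unfolding A by (simp add: mult_ac)
      then have lo': "(1 - \<kappa>/4) * v n < A" using cpos by (simp only: mult_less_cancel_right_pos)
      have "((1 - \<epsilon>) * A) * (real n * real n * \<epsilon>) < ((1 + \<kappa>/4) * v n) * (real n * real n * \<epsilon>)"
        using up D(2) unfolding A by (simp add: mult_ac)
      then have up': "(1 - \<epsilon>) * A < (1 + \<kappa>/4) * v n" using cpos by (simp only: mult_less_cancel_right_pos)
      have "(1 + \<kappa>/4) * v n \<le> (1 - \<epsilon>) * ((1 + \<kappa>) * v n)"
      proof -
        have "\<epsilon> * (1 + \<kappa>) \<le> (\<kappa> / 8) * 2" using \<epsilon> \<kappa> by (intro mult_mono) auto
        then have "1 + \<kappa>/4 \<le> (1 - \<epsilon>) * (1 + \<kappa>)" using \<kappa> by (simp add: algebra_simps)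
        then show ?thesis using v by (simp add: mult.assoc[symmetric])
      qed
      with up' have "(1 - \<epsilon>) * A < (1 - \<epsilon>) * ((1 + \<kappa>) * v n)" by linarith
      then have "A < (1 + \<kappa>) * v n" using l by simp
      with lo' have "\<bar>A - v n\<bar> \<le> \<kappa> * v n" using v \<kappa> by (simp add: abs_le_iff algebra_simps)
      also have "\<dots> \<le> \<eta> * v n" using \<kappa> v by (intro mult_right_mono) auto
      finally show ?case by (simp add: A_def)
    qed
  qed
  then show "\<exists>\<epsilon>0>0. \<forall>\<epsilon>. 0 < \<epsilon> \<and> \<epsilon> < \<epsilon>0 \<longrightarrow>
      (\<forall>\<^sub>F n in sequentially. \<bar>window_average f \<epsilon> n - v n\<bar> \<le> \<eta> * v n)"
    using \<kappa>(1) by (intro exI[of _ "\<kappa> / 8"]) auto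
qed

section \<open>Renewal sequences and their generating functions\<close>

text \<open>
Dominated convergence: the factor k/n is at most 1 and tends to 0 for fixed k.
\<close>

lemma average_weighted_tendsto_0:
  assumes "summable a" "\<And>n. a n \<ge> (0::real)"
  shows "(\<lambda>n. (\<Sum>k\<le>n. real k * a k) / real n) \<longlonglongrightarrow> 0"
proof -
  define b where "b k n = (if k \<le> n then real k * a k / real n else 0)" for k n :: nat
  have "(\<lambda>n. \<Sum>k. b k n) \<longlonglongrightarrow> (\<Sum>k. 0)"
  proof (rule tannerys_theorem[THEN conjunct2, THEN conjunct2])
    show "(\<lambda>n. b k n) \<longlonglongrightarrow> 0" for k
    proof (rule Lim_transform_eventually)
      show "(\<lambda>n. (real k * a k) * (1 / real n)) \<longlonglongrightarrow> 0"
        using tendsto_mult[OF tendsto_const lim_1_over_n, of "real k * a k"] by simp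
      show "\<forall>\<^sub>F n in sequentially. (real k * a k) * (1 / real n) = b k n"
        using eventually_ge_at_top[of k] by eventually_elim (simp add: b_def)
    qed
    have "norm (b k n) \<le> a k" for k n
    proof (cases "k \<le> n \<and> k > 0")
      case True
      then have "real k * a k \<le> real n * a k" using assms(2) by (intro mult_right_mono) auto
      then show ?thesis using True assms(2)[of k] by (simp add: b_def field_simps)
    qed (use assms(2)[of k] in \<open>auto simp: b_def\<close>)
    then show "\<forall>\<^sub>F (k, n) in sequentially \<times>\<^sub>F sequentially. norm (b k n) \<le> a k"
      by (intro always_eventually) auto
  qed (use assms in auto)
  moreover have "(\<Sum>k. b k n) = (\<Sum>k\<le>n. real k * a k) / real n" for n
  proof -
    have "(\<Sum>k. b k n) = (\<Sum>k\<le>n. b k n)" by (rule suminf_finite) (auto simp: b_def)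
    then show ?thesis by (simp add: b_def sum_divide_distrib)
  qed
  ultimately show ?thesis by simp
qed

lemma X_deriv_nth: "fps_nth (fps_X * fps_deriv (Abs_fps a)) n = real n * (a n :: real)"
  by (cases n) simp_all

text \<open>
The analytic content of a renewal process: increment probabilities f, renewal probabilities u and tails
r.  The tails do not tend to 0 when increments are infinite with positive probability.
\<close>

locale renewal_sequence =
  fixes f u r :: "nat \<Rightarrow> real"
  assumes f_nonneg: "f n \<ge> 0" and f_0: "f 0 = 0"
    and r_eq: "r n = 1 - (\<Sum>k\<le>n. f k)" and r_nonneg: "r n \<ge> 0"
    and u_eq: "u n = of_bool (n = 0) + (\<Sum>j\<le>n. u j * f (n - j))"
begin

lemma u_nonneg: "u n \<ge> 0"
proof (induction n rule: less_induct)
  case (less n)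
  have "u j * f (n - j) \<ge> 0" if "j \<le> n" for j
    using less[of j] f_nonneg[of "n - j"] f_0 that by (cases "j = n") auto
  then show ?case by (subst u_eq) (auto intro!: add_nonneg_nonneg sum_nonneg)
qed

lemma u_0: "u 0 = 1" using u_eq[of 0] f_0 by simp

lemma r_antimono: "m \<le> n \<Longrightarrow> r n \<le> r m"
  unfolding r_eq using sum_mono2[of "{..n}" "{..m}" f] f_nonneg by auto

definition "inc_gf = Abs_fps f"
definition "ren_gf = Abs_fps u"
definition "tail_gf = Abs_fps r"
definition ones_gf :: "real fps" where "ones_gf = Abs_fps (\<lambda>_. 1)"

lemma nth_mult_ones_gf: "fps_nth (A * ones_gf) n = (\<Sum>k\<le>n. fps_nth A k)"
  by (simp add: ones_gf_def fps_mult_nth atMost_atLeast0)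

lemma ren_gf_mult: "ren_gf * (1 - inc_gf) = 1"
proof -
  have "ren_gf = 1 + ren_gf * inc_gf"
  proof (rule fps_ext)
    fix n show "fps_nth ren_gf n = fps_nth (1 + ren_gf * inc_gf) n"
      unfolding ren_gf_def inc_gf_def fps_add_nth fps_mult_nth fps_one_nth fps_nth_Abs_fps
      by (subst u_eq) (simp add: atMost_atLeast0)
  qed
  then show ?thesis by (simp add: algebra_simps)
qed

lemma tail_gf_eq: "tail_gf = (1 - inc_gf) * ones_gf"
  by (rule fps_ext, unfold nth_mult_ones_gf) (simp add: tail_gf_def inc_gf_def r_eq sum_subtractf)

lemma ren_gf_mult_tail_gf: "ren_gf * tail_gf = ones_gf"
proof -
  have "ren_gf * tail_gf = (ren_gf * (1 - inc_gf)) * ones_gf" by (simp add: tail_gf_eq mult.assoc)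
  then show ?thesis by (simp add: ren_gf_mult)
qed

lemma sum_tail_mult_sum_u: "(\<Sum>j\<le>n. r j * (\<Sum>k\<le>n - j. u k)) = real n + 1"
proof -
  have "tail_gf * (ren_gf * ones_gf) = ones_gf * ones_gf" using ren_gf_mult_tail_gf by (simp add: mult_ac)
  from arg_cong[OF this, of "\<lambda>A. fps_nth A n"] show ?thesis
    unfolding nth_mult_ones_gf by (simp add: fps_mult_nth[of tail_gf] nth_mult_ones_gf) (simp add: tail_gf_def ren_gf_def ones_gf_def atMost_atLeast0)
qed

lemma deriv_inc_gf: "fps_deriv inc_gf = fps_deriv ren_gf * ((1 - inc_gf) * (1 - inc_gf))"
proof -
  have "fps_deriv (ren_gf * (1 - inc_gf)) = 0" by (simp add: ren_gf_mult)
  then have *: "ren_gf * fps_deriv inc_gf = fps_deriv ren_gf * (1 - inc_gf)" by simp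
  have "fps_deriv inc_gf = (ren_gf * (1 - inc_gf)) * fps_deriv inc_gf" by (simp add: ren_gf_mult)
  also have "\<dots> = (ren_gf * fps_deriv inc_gf) * (1 - inc_gf)" by (simp add: mult_ac)
  also have "\<dots> = fps_deriv ren_gf * ((1 - inc_gf) * (1 - inc_gf))" by (simp add: * mult_ac)
  finally show ?thesis .
qed

text \<open>
Since r(s) = (1 - f(s)) / (1 - s), dividing the differential equation by (1 - s)^2 turns the two
factors 1 - f(s) into factors r(s).  The left-hand side becomes a sum of a monotone sequence,
to which the monotone density theorem applies.
\<close>

lemma double_sum_eq:
  "(\<Sum>m\<le>n. \<Sum>j\<le>m. real j * f j) = (\<Sum>k\<le>n. (\<Sum>j\<le>k. real j * u j * r (k - j)) * r (n - k))"
proof -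
  have "fps_X * fps_deriv inc_gf * ones_gf * ones_gf = fps_X * fps_deriv ren_gf * tail_gf * tail_gf"
    by (simp add: deriv_inc_gf tail_gf_eq mult_ac)
  from arg_cong[OF this, of "\<lambda>A. fps_nth A n"]
  have "(\<Sum>m\<le>n. \<Sum>j\<le>m. fps_nth (fps_X * fps_deriv inc_gf) j) = fps_nth (fps_X * fps_deriv ren_gf * tail_gf * tail_gf) n"
    by (simp only: nth_mult_ones_gf)
  also have "\<dots> = (\<Sum>k\<le>n. (\<Sum>j\<le>k. fps_nth (fps_X * fps_deriv ren_gf) j * r (k - j)) * r (n - k))"
    unfolding fps_mult_nth[of _ tail_gf] by (simp only: tail_gf_def fps_nth_Abs_fps atMost_atLeast0)
  finally show ?thesis by (simp only: inc_gf_def ren_gf_def X_deriv_nth)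
qed

definition diff_seq :: "nat \<Rightarrow> real" where "diff_seq n = of_bool (n = 0) - f n"
definition diff_sq :: "nat \<Rightarrow> real" where "diff_sq n = (\<Sum>i\<le>n. diff_seq i * diff_seq (n - i))"

lemma diff_seq_nth: "fps_nth (1 - inc_gf) n = diff_seq n"
  by (simp add: diff_seq_def inc_gf_def)

lemma diff_sq_nth: "fps_nth ((1 - inc_gf) * (1 - inc_gf)) n = diff_sq n"
  unfolding fps_mult_nth diff_seq_nth diff_sq_def by (simp only: atMost_atLeast0)

lemma n_mult_f_eq: "real n * f n = (\<Sum>j\<le>n. diff_sq j * (real (n - j) * u (n - j)))"
proof -
  have "fps_X * fps_deriv inc_gf = ((1 - inc_gf) * (1 - inc_gf)) * (fps_X * fps_deriv ren_gf)"
    by (simp add: deriv_inc_gf mult_ac)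
  from arg_cong[OF this, of "\<lambda>A. fps_nth A n"]
  have "fps_nth (fps_X * fps_deriv inc_gf) n = (\<Sum>j=0..n. diff_sq j * fps_nth (fps_X * fps_deriv ren_gf) (n - j))"
    unfolding fps_mult_nth[of "(1 - inc_gf) * (1 - inc_gf)"] diff_sq_nth .
  then show ?thesis by (simp only: inc_gf_def ren_gf_def X_deriv_nth atMost_atLeast0)
qed

text \<open>
The expansion u = 1 + f + f^2 u has nonnegative coefficients, and u 0 = 1.
\<close>

lemma f_le_u: "f n \<le> u n"
  and f_conv_le_u: "(\<Sum>i\<le>n. f i * f (n - i)) \<le> u n"
proof -
  have ren1: "ren_gf = 1 + ren_gf * inc_gf" using ren_gf_mult by (simp add: algebra_simps)
  have "ren_gf = 1 + inc_gf + ren_gf * (inc_gf * inc_gf)" by (subst ren1, subst ren1) (simp add: algebra_simps)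
  from arg_cong[OF this, of "\<lambda>A. fps_nth A n"]
  have eq: "u n = of_bool (n = 0) + f n + (\<Sum>k\<le>n. u k * (\<Sum>i\<le>n - k. f i * f (n - k - i)))"
    by (simp add: ren_gf_def inc_gf_def fps_mult_nth atMost_atLeast0)
  have nn: "u k * (\<Sum>i\<le>n - k. f i * f (n - k - i)) \<ge> 0" for k
    by (intro mult_nonneg_nonneg u_nonneg sum_nonneg f_nonneg)
  then have 1: "(\<Sum>k\<le>n. u k * (\<Sum>i\<le>n - k. f i * f (n - k - i))) \<ge> 0" by (intro sum_nonneg)
  have 2: "u 0 * (\<Sum>i\<le>n - 0. f i * f (n - 0 - i)) \<le> (\<Sum>k\<le>n. u k * (\<Sum>i\<le>n - k. f i * f (n - k - i)))"
    by (rule member_le_sum) (use nn in auto)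
  have "of_bool (n = 0) \<ge> (0::real)" by simp
  show "f n \<le> u n" using 1 eq \<open>of_bool (n = 0) \<ge> (0::real)\<close> by linarith
  show "(\<Sum>i\<le>n. f i * f (n - i)) \<le> u n"
    using 2 eq f_nonneg[of n] \<open>of_bool (n = 0) \<ge> (0::real)\<close> unfolding u_0 mult_1 diff_zero by linarith
qed

lemma abs_diff_sq_le: "\<bar>diff_sq n\<bar> \<le> 4 * u n"
proof -
  have "(1 - inc_gf) * (1 - inc_gf) = 1 - inc_gf - inc_gf + inc_gf * inc_gf" by (simp add: algebra_simps)
  then have "diff_sq n = fps_nth (1 - inc_gf - inc_gf + inc_gf * inc_gf) n" using diff_sq_nth[of n] by (simp only:)
  also have "\<dots> = of_bool (n = 0) - 2 * f n + (\<Sum>i\<le>n. f i * f (n - i))"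
    unfolding fps_add_nth fps_sub_nth fps_mult_nth fps_one_nth inc_gf_def fps_nth_Abs_fps atMost_atLeast0 by simp
  finally have "diff_sq n = of_bool (n = 0) - 2 * f n + (\<Sum>i\<le>n. f i * f (n - i))" .
  moreover have "(\<Sum>i\<le>n. f i * f (n - i)) \<ge> 0" by (intro sum_nonneg mult_nonneg_nonneg f_nonneg)
  moreover have "of_bool (n = 0) \<le> u n" using u_0 u_nonneg[of n] by simp
  moreover have "of_bool (n = 0) \<ge> (0::real)" by simp
  ultimately show ?thesis using f_le_u[of n] f_nonneg[of n] f_conv_le_u[of n] by linarith
qed

section \<open>The tail of the increments\<close>

text \<open>
Let S and V be the partial sums of r and u.  From sum_tail_mult_sum_u one gets
n + 1 \<le> S n * V n and, for every m, S n * V m \<le> n + m + 1.  For m = \<delta> n, slow variation of V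
makes the bounds match as \<delta> tends to 0, and S n ~ n / V n.
\<close>

lemma tail_asymp:
  assumes U: "slowly_varying (\<lambda>n. \<Sum>k\<le>n. u k)"
  shows "r \<sim>[sequentially] (\<lambda>n. inverse (\<Sum>k\<le>n. u k))"
proof -
  define V where "V n = (\<Sum>k\<le>n. u k)" for n
  have V1: "V n \<ge> 1" for n
    unfolding V_def using member_le_sum[of 0 "{..n}" u] u_nonneg by (simp add: u_0)
  then have Vpos: "V n > 0" for n by (rule less_le_trans[OF zero_less_one])
  have Vmono: "m \<le> n \<Longrightarrow> V m \<le> V n" for m n
    unfolding V_def by (intro sum_mono2) (auto simp: u_nonneg)
  have Vratio: "(\<lambda>n. V (nat \<lfloor>l * real n\<rfloor>) / V n) \<longlonglongrightarrow> 1" if "l > 0" for l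
    using U that by (simp add: slowly_varying_def regularly_varying_index_def V_def)
  have Vratio': "(\<lambda>n. V n / V (nat \<lfloor>l * real n\<rfloor>)) \<longlonglongrightarrow> 1" if "l > 0" for l
    using tendsto_inverse[OF Vratio[OF that]] by simp
  define S where "S n = (\<Sum>j\<le>n. r j)" for n
  have lower: "S n * V n \<ge> real n + 1" for n
  proof -
    have "real n + 1 = (\<Sum>j\<le>n. r j * V (n - j))" using sum_tail_mult_sum_u by (simp add: V_def)
    also have "\<dots> \<le> (\<Sum>j\<le>n. r j * V n)" by (intro sum_mono mult_left_mono Vmono r_nonneg) auto
    finally show ?thesis by (simp add: S_def sum_distrib_right)
  qed
  have upper: "S n * V m \<le> real n + real m + 1" for n m
  proof -
    have "S n * V m = (\<Sum>j\<le>n. r j * V m)" by (simp add: S_def sum_distrib_right)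
    also have "\<dots> \<le> (\<Sum>j\<le>n. r j * V (n + m - j))" by (intro sum_mono mult_left_mono Vmono r_nonneg) auto
    also have "\<dots> \<le> (\<Sum>j\<le>n + m. r j * V (n + m - j))"
      by (intro sum_mono2) (auto intro!: mult_nonneg_nonneg r_nonneg less_imp_le[OF Vpos])
    also have "\<dots> = real (n + m) + 1" using sum_tail_mult_sum_u by (simp add: V_def)
    finally show ?thesis by simp
  qed
  have SV: "(\<lambda>n. S n * V n / real n) \<longlonglongrightarrow> 1"
  proof (rule order_tendstoI)
    fix c :: real assume "c < 1"
    show "\<forall>\<^sub>F n in sequentially. c < S n * V n / real n"
      using eventually_gt_at_top[of 0]
    proof eventually_elim
      case (elim n)
      have "1 \<le> S n * V n / real n" using lower[of n] elim by (simp add: pos_le_divide_eq)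
      with \<open>c < 1\<close> show ?case by linarith
    qed
  next
    fix c :: real assume "1 < c"
    define \<delta> where "\<delta> = (c - 1) / 2"
    have \<delta>: "\<delta> > 0" "1 + \<delta> < c" using \<open>1 < c\<close> by (auto simp: \<delta>_def field_simps)
    define m where "m n = nat \<lfloor>\<delta> * real n\<rfloor>" for n
    have "(\<lambda>n. (1 + real (m n) / real n + 1 / real n) * (V n / V (m n))) \<longlonglongrightarrow> (1 + \<delta> + 0) * 1"
      unfolding m_def using \<delta>
      by (intro tendsto_mult tendsto_add tendsto_const nat_floor_mult_over_tendsto Vratio' lim_1_over_n) auto
    then have "\<forall>\<^sub>F n in sequentially. (1 + real (m n) / real n + 1 / real n) * (V n / V (m n)) < c"
      using \<delta> by (intro order_tendstoD(2)) auto
    then show "\<forall>\<^sub>F n in sequentially. S n * V n / real n < c"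
      using eventually_gt_at_top[of 0]
    proof eventually_elim
      case (elim n)
      have "S n * V n / real n = (S n * V (m n)) * (V n / V (m n) / real n)" using Vpos[of "m n"] by simp
      also have "\<dots> \<le> (real n + real (m n) + 1) * (V n / V (m n) / real n)"
        using upper[of n "m n"] Vpos[of n] Vpos[of "m n"] by (intro mult_right_mono) auto
      also have "\<dots> = (1 + real (m n) / real n + 1 / real n) * (V n / V (m n))"
        using elim(2) by (simp add: field_simps)
      finally show ?case using elim(1) by linarith
    qed
  qed
  have "(\<lambda>n. (- r n) / inverse (V n)) \<longlonglongrightarrow> - 1"
  proof (rule monotone_density[where \<phi> = "\<lambda>l. - l"])
    show "mono (\<lambda>n. - r n)" by (intro monoI) (simp add: r_antimono)
    show "\<forall>\<^sub>F n in sequentially. inverse (V n) > 0" using Vpos by simp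
    show "((\<lambda>l. - l) has_real_derivative - 1) (at 1)" by (auto intro!: derivative_eq_intros)
    fix l :: real assume l: "l > 0"
    define m where "m n = nat \<lfloor>l * real n\<rfloor>" for n
    have m_lim: "filterlim m sequentially sequentially"
      unfolding m_def by (rule filterlim_nat_floor_mult[OF l])
    have "(\<lambda>n. - (S (m n) * V (m n) / real (m n) * (real (m n) / real n) * (V n / V (m n)))) \<longlonglongrightarrow> - (1 * l * 1)"
      using filterlim_compose[OF SV m_lim] nat_floor_mult_over_tendsto[OF l] Vratio'[OF l]
      by (intro tendsto_minus tendsto_mult) (simp_all add: m_def)
    moreover have "\<forall>\<^sub>F n in sequentially. - (S (m n) * V (m n) / real (m n) * (real (m n) / real n) * (V n / V (m n)))
        = (\<Sum>j\<le>m n. - r j) / (real n * inverse (V n))"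
      using m_lim[unfolded filterlim_iff, rule_format, OF eventually_gt_at_top[of 0]]
    proof eventually_elim
      case (elim n)
      have "V (m n) \<noteq> 0" "V n \<noteq> 0" using Vpos less_irrefl by metis+
      then show ?case using elim by (simp add: S_def sum_negf field_simps)
    qed
    ultimately have "(\<lambda>n. (\<Sum>j\<le>m n. - r j) / (real n * inverse (V n))) \<longlonglongrightarrow> - (1 * l * 1)"
      by (rule Lim_transform_eventually)
    then show "(\<lambda>n. (\<Sum>j\<le>nat \<lfloor>l * real n\<rfloor>. - r j) / (real n * inverse (V n))) \<longlonglongrightarrow> - l"
      by (simp add: m_def)
  qed
  from tendsto_minus[OF this] show ?thesis
    by (intro asymp_equivI') (simp add: V_def)
qed

lemma tail_slowly_varying:
  assumes "slowly_varying (\<lambda>n. \<Sum>k\<le>n. u k)"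
  shows "slowly_varying r"
  unfolding slowly_varying_def
  using regularly_varying_index_asymp_equiv[OF regularly_varying_index_inverse tail_asymp[OF assms], of 0]
    assms by (simp add: slowly_varying_def)

section \<open>The critical index\<close>

text \<open>
If \<rho> > -1, then u n is at least of order n^(\<kappa> - 1) for some \<kappa> > 0, and the partial sums of u grow at
least like n^\<kappa>, too fast for a slowly varying sequence.
\<close>

lemma index_le_minus_1:
  assumes u: "regularly_varying_index u \<rho>" and U: "slowly_varying (\<lambda>n. \<Sum>k\<le>n. u k)"
  shows "\<rho> \<le> -1"
proof (rule ccontr)
  assume "\<not> \<rho> \<le> -1"
  \<comment> \<open>The cap at 1 makes the exponent \<kappa> - 1 negative, so that n^(\<kappa> - 1) \<le> k^(\<kappa> - 1) for 1 \<le> k \<le> n.\<close>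
  define \<kappa> where "\<kappa> = min (\<rho> + 1) 1 / 2"
  have \<kappa>: "\<kappa> > 0" "\<kappa> < 1" "-1 + \<kappa> \<le> \<rho> - \<kappa>" using \<open>\<not> \<rho> \<le> -1\<close> by (auto simp: \<kappa>_def min_def)
  have "slowly_varying (\<lambda>n. u n * real n powr - \<rho>)"
    unfolding slowly_varying_def using regularly_varying_index_mult[OF u regularly_varying_index_powr[of "- \<rho>"]] by simp
  then obtain c C where c: "c > 0" "C > 0" and "\<forall>\<^sub>F n in sequentially. c * real n powr - \<kappa> \<le> u n * real n powr - \<rho> \<and> u n * real n powr - \<rho> \<le> C * real n powr \<kappa>"
    by (rule slowly_varying_powr_bounds[OF _ \<kappa>(1)])
  then have ev: "\<forall>\<^sub>F n in sequentially. c * real n powr - \<kappa> \<le> u n * real n powr - \<rho>"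
    by (auto elim: eventually_mono)
  have "\<kappa> / 2 > 0" using \<kappa> by simp
  then obtain c' C' where C': "c' > 0" "C' > 0" and "\<forall>\<^sub>F n in sequentially. c' * real n powr - (\<kappa> / 2) \<le> (\<Sum>k\<le>n. u k) \<and> (\<Sum>k\<le>n. u k) \<le> C' * real n powr (\<kappa> / 2)"
    by (rule slowly_varying_powr_bounds[OF U])
  then have ev': "\<forall>\<^sub>F n in sequentially. (\<Sum>k\<le>n. u k) \<le> C' * real n powr (\<kappa> / 2)"
    by (auto elim: eventually_mono)
  have "\<forall>\<^sub>F n in sequentially. c * real n powr (- 1 + \<kappa>) \<le> u n"
    using ev eventually_ge_at_top[of 1]
  proof eventually_elim
    case (elim n)
    have "c * real n powr (- 1 + \<kappa>) \<le> c * real n powr (\<rho> - \<kappa>)"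
      using c \<kappa> elim by (intro mult_left_mono powr_mono) auto
    also have "\<dots> = (c * real n powr - \<kappa>) * real n powr \<rho>" by (simp flip: powr_add)
    also have "\<dots> \<le> (u n * real n powr - \<rho>) * real n powr \<rho>" using elim by (intro mult_right_mono) auto
    also have "\<dots> = u n" using elim by (simp add: mult.assoc flip: powr_add)
    finally show ?case .
  qed
  then obtain N where N: "\<And>n. n \<ge> N \<Longrightarrow> c * real n powr (- 1 + \<kappa>) \<le> u n"
    unfolding eventually_sequentially by blast
  have low: "c / 2 * real n powr \<kappa> \<le> (\<Sum>k\<le>n. u k)" if n: "n \<ge> 2 * N" "n > 0" for n
  proof -
    have "c / 2 * real n powr \<kappa> = (real n / 2) * (c * real n powr (- 1 + \<kappa>))"
      using powr_mult_base[of "real n" "- 1 + \<kappa>"] by simp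
    also have "\<dots> \<le> real (card {max N 1..n}) * (c * real n powr (- 1 + \<kappa>))"
      using n c by (intro mult_right_mono) (auto simp: of_nat_diff max_def)
    also have "\<dots> = (\<Sum>k\<in>{max N 1..n}. c * real n powr (- 1 + \<kappa>))" by simp
    also have "\<dots> \<le> (\<Sum>k\<in>{max N 1..n}. u k)"
    proof (rule sum_mono)
      fix k assume k: "k \<in> {max N 1..n}"
      have "c * real n powr (- 1 + \<kappa>) \<le> c * real k powr (- 1 + \<kappa>)"
        using k c \<kappa> by (intro mult_left_mono powr_mono2') auto
      also have "\<dots> \<le> u k" using N k by auto
      finally show "c * real n powr (- 1 + \<kappa>) \<le> u k" .
    qed
    also have "\<dots> \<le> (\<Sum>k\<le>n. u k)" by (intro sum_mono2) (auto simp: u_nonneg)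
    finally show ?thesis .
  qed
  have "filterlim (\<lambda>n. real n powr (\<kappa> / 2)) at_top sequentially"
    using \<kappa> by (intro filterlim_compose[OF real_powr_at_top filterlim_real_sequentially]) auto
  then have "\<forall>\<^sub>F n in sequentially. real n powr (\<kappa> / 2) > 2 * C' / c" by (simp add: filterlim_at_top_dense)
  with ev' have "\<forall>\<^sub>F n in sequentially. False"
    using eventually_ge_at_top[of "max (2 * N) 1"]
  proof eventually_elim
    case (elim n)
    define p where "p = real n powr (\<kappa> / 2)"
    have p: "p > 0" "real n powr \<kappa> = p * p" using elim by (auto simp: p_def simp flip: powr_add)
    have "c / 2 * real n powr \<kappa> \<le> (\<Sum>k\<le>n. u k)" using elim by (intro low) auto
    also have "\<dots> \<le> C' * real n powr (\<kappa> / 2)" using elim by simp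
    finally have "c / 2 * (p * p) \<le> C' * p" unfolding p(2) p_def[symmetric] .
    then have "c * p \<le> 2 * C'" using p(1) by simp
    then show False using elim c unfolding p_def[symmetric] by (simp add: divide_less_eq mult.commute)
  qed
  then show False by simp
qed

text \<open>
The double sum of double_sum_eq is evaluated by two convolutions with r.  The first one, A,
is n times a slowly varying sequence A', and the second is a convolution of A' with r under
the weight k.
\<close>

lemma window_equiv_index_minus_1:
  assumes u: "regularly_varying_index u (-1)" and U: "slowly_varying (\<lambda>n. \<Sum>k\<le>n. u k)"
  shows "window_equiv f (\<lambda>n. (r n)\<^sup>2 * u n)"
proof -
  define L where "L n = real n * u n" for n
  define A where "A n = (\<Sum>k\<le>n. L k * r (n - k))" for n
  define A' where "A' n = A n / real n" for n
  define T where "T n = (\<Sum>k\<le>n. real k * f k)" for n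
  define q where "q n = L n * (r n)\<^sup>2" for n
  have r: "slowly_varying r" by (rule tail_slowly_varying[OF U])
  have L: "slowly_varying L"
  proof -
    have "regularly_varying_index (\<lambda>n. real n powr 1 * u n) (1 + - 1)"
      by (intro regularly_varying_index_mult regularly_varying_index_powr u)
    then show ?thesis by (simp add: slowly_varying_def L_def[abs_def])
  qed
  have L0: "L n \<ge> 0" for n by (simp add: L_def u_nonneg)
  have A0: "A' n \<ge> 0" for n unfolding A'_def A_def by (intro divide_nonneg_nonneg sum_nonneg mult_nonneg_nonneg L0 r_nonneg) simp
  have "(\<lambda>n. (\<Sum>k\<le>n. 1 * L k * r (n - k)) / (real n * 1 * L n * r n)) \<longlonglongrightarrow> 1"
  proof (rule sum_conv_weighted_tendsto[OF L r L0 r_nonneg])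
    have "(\<lambda>n. 1 + 1 / real n) \<longlonglongrightarrow> 1 + 0" by (intro tendsto_add tendsto_const lim_1_over_n)
    moreover have "\<forall>\<^sub>F n in sequentially. 1 + 1 / real n = (\<Sum>k\<le>n. 1) / (real n * 1)"
      using eventually_gt_at_top[of 0] by eventually_elim (simp add: field_simps)
    ultimately show "(\<lambda>n. (\<Sum>k\<le>n. 1) / (real n * 1)) \<longlonglongrightarrow> (1::real)"
      using Lim_transform_eventually by fastforce
  qed (auto intro: monoI)
  then have Alim: "(\<lambda>n. A' n / (L n * r n)) \<longlonglongrightarrow> 1" by (simp add: A'_def A_def mult_ac)
  have Lr: "slowly_varying (\<lambda>n. L n * r n)"
    using regularly_varying_index_mult[of L 0 r 0] L r by (simp add: slowly_varying_def)
  have A': "slowly_varying A'"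
    using regularly_varying_index_asymp_equiv[OF Lr[unfolded slowly_varying_def] asymp_equivI'[OF Alim]]
    by (simp add: slowly_varying_def)
  have half: "(\<lambda>n. (\<Sum>k\<le>n. real k * A' k * r (n - k)) / (real n * real n * A' n * r n)) \<longlonglongrightarrow> 1/2"
  proof (rule sum_conv_weighted_tendsto[OF A' r A0 r_nonneg])
    have "(\<lambda>n. 1/2 + 1/2 * (1 / real n)) \<longlonglongrightarrow> 1/2 + 1/2 * 0"
      by (intro tendsto_add tendsto_mult tendsto_const lim_1_over_n)
    moreover have "\<forall>\<^sub>F n in sequentially. 1/2 + 1/2 * (1 / real n) = (\<Sum>k\<le>n. real k) / (real n * real n)"
      using eventually_gt_at_top[of 0]
    proof eventually_elim
      case (elim n)
      have "(\<Sum>k\<le>n. real k) = real n * (real n + 1) / 2" by (induction n) (auto simp: field_simps)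
      then show ?case using elim by (simp add: field_simps)
    qed
    ultimately show "(\<lambda>n. (\<Sum>k\<le>n. real k) / (real n * real n)) \<longlonglongrightarrow> 1/2"
      using Lim_transform_eventually by fastforce
    show "\<forall>\<^sub>F n in sequentially. 0 < real n" using eventually_gt_at_top[of 0] by eventually_elim simp
  qed (auto intro: monoI)
  have H_eq: "(\<Sum>m\<le>n. T m) = (\<Sum>k\<le>n. real k * A' k * r (n - k))" for n
  proof -
    \<comment> \<open>At k = 0 both sides vanish: L 0 = 0, and A' 0 is a division by zero.\<close>
    have "real k * A' k = A k" for k by (cases "k = 0") (simp_all add: A'_def A_def L_def)
    then show ?thesis using double_sum_eq[of n] by (simp add: T_def A_def L_def)
  qed
  have q: "slowly_varying q"
    using regularly_varying_index_mult[OF Lr[unfolded slowly_varying_def] r[unfolded slowly_varying_def]]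
    by (simp add: slowly_varying_def q_def[abs_def] power2_eq_square mult.assoc)
  have pos: "\<forall>\<^sub>F n in sequentially. A' n > 0" "\<forall>\<^sub>F n in sequentially. r n > 0" "\<forall>\<^sub>F n in sequentially. q n > 0"
    using A' r q by (auto simp: slowly_varying_def regularly_varying_index_def)
  have "(\<lambda>n. (\<Sum>k\<le>n. real k * A' k * r (n - k)) / (real n * real n * A' n * r n) * (A' n / (L n * r n))) \<longlonglongrightarrow> 1/2 * 1"
    by (intro tendsto_mult half Alim)
  moreover have "\<forall>\<^sub>F n in sequentially. (\<Sum>k\<le>n. real k * A' k * r (n - k)) / (real n * real n * A' n * r n) * (A' n / (L n * r n))
      = (\<Sum>m\<le>n. T m) / (real n * real n * q n)"
    using pos(1) by eventually_elim (simp add: H_eq q_def power2_eq_square mult_ac)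
  ultimately have "(\<lambda>n. (\<Sum>m\<le>n. T m) / (real n * real n * q n)) \<longlonglongrightarrow> 1/2 * 1"
    by (rule Lim_transform_eventually)
  then have Hlim: "(\<lambda>n. (\<Sum>m\<le>n. T m) / (real n * real n * q n)) \<longlonglongrightarrow> 1/2" by simp
  have "(\<lambda>n. T n / (real n * q n)) \<longlonglongrightarrow> 1"
  proof (rule monotone_density[where \<phi> = "\<lambda>l. l\<^sup>2 / 2"])
    show "mono T" unfolding T_def by (intro monoI sum_mono2) (auto simp: f_nonneg)
    show "\<forall>\<^sub>F n in sequentially. real n * q n > 0"
      using pos(3) eventually_gt_at_top[of 0] by eventually_elim simp
    show "((\<lambda>l. l\<^sup>2 / 2) has_real_derivative 1) (at 1)" by (auto intro!: derivative_eq_intros)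
    fix l :: real assume l: "l > 0"
    define m where "m n = nat \<lfloor>l * real n\<rfloor>" for n
    have m_lim: "filterlim m sequentially sequentially"
      unfolding m_def by (rule filterlim_nat_floor_mult[OF l])
    have "(\<lambda>n. (\<Sum>i\<le>m n. T i) / (real (m n) * real (m n) * q (m n)) * (real (m n) / real n)\<^sup>2 * (q (m n) / q n))
        \<longlonglongrightarrow> 1/2 * l\<^sup>2 * 1"
      using filterlim_compose[OF Hlim m_lim] nat_floor_mult_over_tendsto[OF l] q l
      by (intro tendsto_mult tendsto_power) (simp_all add: m_def slowly_varying_def regularly_varying_index_def)
    moreover have "\<forall>\<^sub>F n in sequentially. (\<Sum>i\<le>m n. T i) / (real (m n) * real (m n) * q (m n)) * (real (m n) / real n)\<^sup>2 * (q (m n) / q n)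
        = (\<Sum>i\<le>m n. T i) / (real n * (real n * q n))"
      using m_lim[unfolded filterlim_iff, rule_format, OF eventually_gt_at_top[of 0]]
        m_lim[unfolded filterlim_iff, rule_format, OF pos(3)]
      by eventually_elim (simp add: power2_eq_square)
    ultimately have "(\<lambda>n. (\<Sum>i\<le>m n. T i) / (real n * (real n * q n))) \<longlonglongrightarrow> 1/2 * l\<^sup>2 * 1"
      by (rule Lim_transform_eventually)
    then show "(\<lambda>n. (\<Sum>i\<le>nat \<lfloor>l * real n\<rfloor>. T i) / (real n * (real n * q n))) \<longlonglongrightarrow> l\<^sup>2 / 2"
      by (simp add: m_def)
  qed
  moreover have qv: "q n = real n * ((r n)\<^sup>2 * u n)" for n by (simp add: q_def L_def)
  ultimately show ?thesis
    using q by (intro window_equiv_of_weighted_sum f_nonneg) (simp_all add: T_def qv[abs_def])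
qed

section \<open>Summable renewal sequences\<close>

lemma summable_of_index_less:
  assumes u: "regularly_varying_index u \<rho>" and "\<rho> < -1"
  shows "summable u"
proof -
  define \<kappa> where "\<kappa> = (- 1 - \<rho>) / 2"
  have \<kappa>: "\<kappa> > 0" "\<rho> + \<kappa> < -1" using assms(2) by (auto simp: \<kappa>_def field_simps)
  have "slowly_varying (\<lambda>n. u n * real n powr - \<rho>)"
    unfolding slowly_varying_def using regularly_varying_index_mult[OF u regularly_varying_index_powr[of "- \<rho>"]] by simp
  then obtain c C where c: "c > 0" "C > 0"
    and ev: "\<forall>\<^sub>F n in sequentially. c * real n powr - \<kappa> \<le> u n * real n powr - \<rho> \<and> u n * real n powr - \<rho> \<le> C * real n powr \<kappa>"
    by (rule slowly_varying_powr_bounds[OF _ \<kappa>(1)])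
  from ev eventually_ge_at_top[of 1]
  have "\<forall>\<^sub>F n in sequentially. norm (u n) \<le> C * real n powr (\<rho> + \<kappa>)"
  proof eventually_elim
    case (elim n)
    have "u n = (u n * real n powr - \<rho>) * real n powr \<rho>"
      using elim by (simp add: mult.assoc flip: powr_add)
    also have "\<dots> \<le> (C * real n powr \<kappa>) * real n powr \<rho>" using elim by (intro mult_right_mono) auto
    also have "\<dots> = C * real n powr (\<rho> + \<kappa>)" by (simp add: powr_add)
    finally show ?case using u_nonneg[of n] by simp
  qed
  moreover have "summable (\<lambda>n. C * real n powr (\<rho> + \<kappa>))"
    using \<kappa> by (intro summable_mult) (simp add: summable_real_powr_iff)
  ultimately show ?thesis by (rule summable_comparison_test_ev)
qed

text \<open>
The series of u and of 1 - f have product 1 by Cauchy multiplication, so 1 - f(1), which is the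
limit of the tails, is not zero.
\<close>

lemma summable_diff_seq:
  assumes "summable u" shows "summable (\<lambda>n. norm (diff_seq n))" "summable diff_seq" "r \<longlonglongrightarrow> suminf diff_seq" "suminf diff_seq \<noteq> 0"
proof -
  have f: "summable f" using assms f_nonneg f_le_u by (intro summable_comparison_test[of f u]) auto
  have "summable (\<lambda>n. of_bool (n = 0) + f n)"
    using f by (intro summable_add) (auto intro!: summable_finite[of "{0}"])
  then show n: "summable (\<lambda>n. norm (diff_seq n))"
    by (rule summable_comparison_test[rotated]) (use f_nonneg in \<open>auto simp: diff_seq_def\<close>)
  then show s: "summable diff_seq" by (rule summable_norm_cancel)
  have "r n = (\<Sum>k\<le>n. diff_seq k)" for n by (simp add: r_eq diff_seq_def sum_subtractf)
  then show "r \<longlonglongrightarrow> suminf diff_seq" using summable_LIMSEQ'[OF s] by presburger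
  have "summable (\<lambda>n. norm (u n))" using assms u_nonneg by simp
  from Cauchy_product_sums[OF this n]
  have "(\<lambda>k. \<Sum>i\<le>k. u i * diff_seq (k - i)) sums (suminf u * suminf diff_seq)" .
  moreover have "(\<Sum>i\<le>k. u i * diff_seq (k - i)) = of_bool (k = 0)" for k
  proof -
    have "fps_nth (ren_gf * (1 - inc_gf)) k = (\<Sum>i\<le>k. u i * diff_seq (k - i))"
      unfolding fps_mult_nth diff_seq_nth by (simp add: ren_gf_def atMost_atLeast0)
    then have "(\<Sum>i\<le>k. u i * diff_seq (k - i)) = fps_nth 1 k" by (simp only: ren_gf_mult)
    then show ?thesis by (simp only: fps_one_nth of_bool_def)
  qed
  moreover have "(\<lambda>k. of_bool (k = 0) :: real) sums 1"
    using sums_single[of 0 "\<lambda>_. 1 :: real"] by (simp add: of_bool_def)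
  ultimately have "suminf u * suminf diff_seq = 1" using sums_unique2 by fastforce
  then show "suminf diff_seq \<noteq> 0" by auto
qed

text \<open>
Divide n f n = sum of g j (n - j) u (n - j) by n u n, where g = diff_sq.  For j \<le> n/2 the ratio of u (n - j) to u n is
bounded and tends to 1 for fixed j, so dominated convergence gives the sum of g, namely
(1 - f(1))^2.  For j > n/2 one has g j = O(u n), and the rest is an average of k u k, which tends to 0.
\<close>

lemma asymp_equiv_of_summable:
  assumes u: "regularly_varying_index u \<rho>" and sum: "summable u"
  shows "f \<sim>[sequentially] (\<lambda>n. (r n)\<^sup>2 * u n)"
proof -
  have upos: "\<forall>\<^sub>F n in sequentially. u n > 0" using u by (auto simp: regularly_varying_index_def)
  define s where "s = suminf diff_seq"
  have s: "r \<longlonglongrightarrow> s" "s \<noteq> 0" using summable_diff_seq[OF sum] by (auto simp: s_def)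
  have "diff_sq sums (s * s)"
    unfolding diff_sq_def[abs_def] s_def by (rule Cauchy_product_sums) (rule summable_diff_seq[OF sum])+
  then have suminf_diff_sq: "suminf diff_sq = s\<^sup>2" by (simp add: sums_iff power2_eq_square)
  \<comment> \<open>On [n/2, n] the ratio (k/n)^\<rho> is at most 2^\<bar>\<rho>\<bar>; the summand 1 absorbs the error of uniform convergence.\<close>
  define C where "C = exp (1 + \<bar>\<rho>\<bar> * ln 2)"
  have C: "C > 0" by (simp add: C_def)
  have half: "0 < (1/2::real)" "(1/2::real) \<le> 1" by auto
  have cmp: "\<forall>\<^sub>F n in sequentially. \<forall>k. n \<le> 2 * k \<and> k \<le> n \<longrightarrow> u k \<le> C * u n"
    using regularly_varying_uniform_below[OF u half zero_less_one] upos eventually_gt_at_top[of 0]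
  proof eventually_elim
    case (elim n)
    show ?case
    proof (intro allI impI)
      fix k assume k: "n \<le> 2 * k \<and> k \<le> n"
      then have k0: "k > 0" using elim by simp
      have "1/2 * real n \<le> real k" using k by linarith
      with elim k have uk: "u k > 0" "\<bar>ln (u k) - ln (u n) - \<rho> * ln (real k / real n)\<bar> \<le> 1" by auto
      have "1/2 \<le> real k / real n" using k elim k0 by (simp add: pos_le_divide_eq)
      then have "ln (1/2) \<le> ln (real k / real n)" using k0 elim by (subst ln_le_cancel_iff) auto
      moreover have "ln (real k / real n) \<le> 0" using k elim k0 by simp
      ultimately have "\<bar>ln (real k / real n)\<bar> \<le> ln 2" by (simp add: ln_div)
      then have "\<bar>\<rho> * ln (real k / real n)\<bar> \<le> \<bar>\<rho>\<bar> * ln 2" unfolding abs_mult by (intro mult_left_mono) auto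
      then have "ln (u k) \<le> (1 + \<bar>\<rho>\<bar> * ln 2) + ln (u n)" using uk by linarith
      then have "exp (ln (u k)) \<le> exp ((1 + \<bar>\<rho>\<bar> * ln 2) + ln (u n))" by simp
      then show "u k \<le> C * u n" using uk elim by (simp only: exp_add C_def exp_ln)
    qed
  qed
  have shift: "(\<lambda>n. u (n - j) / u n) \<longlonglongrightarrow> 1" for j
  proof -
    have ratio: "(\<lambda>n. real (n - j) / real n) \<longlonglongrightarrow> 1"
    proof (rule Lim_transform_eventually)
      show "(\<lambda>n. 1 - real j * (1 / real n)) \<longlonglongrightarrow> 1"
        using tendsto_diff[OF tendsto_const tendsto_mult[OF tendsto_const lim_1_over_n], of 1 "real j"] by simp
      show "\<forall>\<^sub>F n in sequentially. 1 - real j * (1 / real n) = real (n - j) / real n"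
        using eventually_ge_at_top[of "max 1 j"]
        by eventually_elim (simp add: of_nat_diff diff_divide_distrib)
    qed
    have "(\<lambda>n. ln (u (n - j)) - ln (u n) - \<rho> * ln (real (n - j) / real n)) \<longlonglongrightarrow> 0"
    proof (rule tendstoI)
      fix e :: real assume "e > 0"
      then have "e / 2 > 0" by simp
      from regularly_varying_uniform_below[OF u half this] eventually_ge_at_top[of "2 * j"]
      show "\<forall>\<^sub>F n in sequentially. dist (ln (u (n - j)) - ln (u n) - \<rho> * ln (real (n - j) / real n)) 0 < e"
      proof eventually_elim
        case (elim n)
        have "1/2 * real n \<le> real (n - j) \<and> n - j \<le> n" using elim(2) by linarith
        with elim(1) have "\<bar>ln (u (n - j)) - ln (u n) - \<rho> * ln (real (n - j) / real n)\<bar> \<le> e / 2" by blast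
        then show ?case using \<open>e > 0\<close> by simp
      qed
    qed
    moreover have "(\<lambda>n. \<rho> * ln (real (n - j) / real n)) \<longlonglongrightarrow> \<rho> * ln 1"
      by (intro tendsto_mult tendsto_const tendsto_ln ratio) simp
    ultimately have "(\<lambda>n. (ln (u (n - j)) - ln (u n) - \<rho> * ln (real (n - j) / real n)) + \<rho> * ln (real (n - j) / real n)) \<longlonglongrightarrow> 0 + \<rho> * ln 1"
      by (rule tendsto_add)
    then have "(\<lambda>n. exp (ln (u (n - j)) - ln (u n))) \<longlonglongrightarrow> exp 0" by (intro tendsto_exp) simp
    moreover have "\<forall>\<^sub>F n in sequentially. exp (ln (u (n - j)) - ln (u n)) = u (n - j) / u n"
      using upos regularly_varying_uniform_below[OF u half zero_less_one] eventually_ge_at_top[of "2 * j"]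
    proof eventually_elim
      case (elim n)
      have "1/2 * real n \<le> real (n - j) \<and> n - j \<le> n" using elim(3) by linarith
      with elim(2) have "u (n - j) > 0" by blast
      then show ?case using elim(1) by (simp add: exp_diff)
    qed
    ultimately show ?thesis using Lim_transform_eventually by fastforce
  qed
  have shift': "(\<lambda>n. real (n - j) / real n * (u (n - j) / u n)) \<longlonglongrightarrow> 1" for j
  proof -
    have "(\<lambda>n. (1 - real j * (1 / real n)) * (u (n - j) / u n)) \<longlonglongrightarrow> (1 - real j * 0) * 1"
      by (intro tendsto_mult tendsto_diff tendsto_const lim_1_over_n shift)
    moreover have "\<forall>\<^sub>F n in sequentially. (1 - real j * (1 / real n)) * (u (n - j) / u n) = real (n - j) / real n * (u (n - j) / u n)"
      using eventually_ge_at_top[of "max 1 j"]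
      by eventually_elim (simp add: of_nat_diff diff_divide_distrib)
    ultimately show ?thesis using Lim_transform_eventually by fastforce
  qed
  define a where "a j n = (if 2 * j \<le> n then diff_sq j * (real (n - j) / real n * (u (n - j) / u n)) else 0)" for j n
  \<comment> \<open>A collects the indices j \<le> n/2, to which dominated convergence applies, and B the remaining ones.\<close>
  define A where "A n = (\<Sum>j | 2 * j \<le> n. diff_sq j * (real (n - j) * u (n - j)))" for n
  define B where "B n = (\<Sum>j | n < 2 * j \<and> j \<le> n. diff_sq j * (real (n - j) * u (n - j)))" for n
  have fin: "finite {j. 2 * j \<le> n}" for n :: nat by (rule finite_subset[of _ "{..n}"]) auto
  have AB: "real n * f n = A n + B n" for n
  proof -
    have "{..n} = {j. 2 * j \<le> n} \<union> {j. n < 2 * j \<and> j \<le> n}" by auto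
    then show ?thesis unfolding n_mult_f_eq A_def B_def
      by (simp only:) (rule sum.union_disjoint, auto simp: fin)
  qed
  have "(\<lambda>n. \<Sum>j. a j n) \<longlonglongrightarrow> suminf diff_sq"
  proof (rule tannerys_theorem[THEN conjunct2, THEN conjunct2])
    show "(\<lambda>n. a j n) \<longlonglongrightarrow> diff_sq j" for j
    proof (rule Lim_transform_eventually)
      show "(\<lambda>n. diff_sq j * (real (n - j) / real n * (u (n - j) / u n))) \<longlonglongrightarrow> diff_sq j"
        using tendsto_mult[OF tendsto_const shift', of "diff_sq j"] by simp
      show "\<forall>\<^sub>F n in sequentially. diff_sq j * (real (n - j) / real n * (u (n - j) / u n)) = a j n"
        using eventually_ge_at_top[of "2 * j"] by eventually_elim (simp add: a_def)
    qed
    have ev: "\<forall>\<^sub>F n in sequentially. \<forall>j. norm (a j n) \<le> 4 * C * u j"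
      using cmp upos eventually_gt_at_top[of 0]
    proof eventually_elim
      case (elim n)
      show ?case
      proof
        fix j show "norm (a j n) \<le> 4 * C * u j"
        proof (cases "2 * j \<le> n")
          case True
          have "n \<le> 2 * (n - j) \<and> n - j \<le> n" using True by linarith
          with elim(1) have "u (n - j) \<le> C * u n" by blast
          then have q: "u (n - j) / u n \<le> C" "u (n - j) / u n \<ge> 0"
            using elim u_nonneg by (simp_all add: pos_divide_le_eq)
          have "real (n - j) / real n * (u (n - j) / u n) \<le> 1 * C"
            using q elim by (intro mult_mono) (auto simp: divide_le_eq)
          moreover have "0 \<le> real (n - j) / real n * (u (n - j) / u n)" using q by (intro mult_nonneg_nonneg) auto
          ultimately have "\<bar>diff_sq j\<bar> * \<bar>real (n - j) / real n * (u (n - j) / u n)\<bar> \<le> (4 * u j) * C"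
            using u_nonneg by (intro mult_mono abs_diff_sq_le) auto
          then show ?thesis using True by (simp add: a_def abs_mult mult_ac)
        qed (use C u_nonneg in \<open>simp add: a_def\<close>)
      qed
    qed
    show "\<forall>\<^sub>F (j, n) in sequentially \<times>\<^sub>F sequentially. norm (a j n) \<le> 4 * C * u j"
      unfolding eventually_prod_filter using ev by (intro exI[of _ "\<lambda>_. True"] exI[of _ "\<lambda>n. \<forall>j. norm (a j n) \<le> 4 * C * u j"]) auto
    show "summable (\<lambda>j. 4 * C * u j)" using sum by (rule summable_mult)
  qed simp
  moreover have "(\<Sum>j. a j n) = A n / (real n * u n)" for n
  proof -
    have "(\<Sum>j. a j n) = (\<Sum>j | 2 * j \<le> n. a j n)" by (rule suminf_finite[OF fin]) (auto simp: a_def)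
    then show ?thesis by (simp add: a_def A_def sum_divide_distrib)
  qed
  ultimately have A: "(\<lambda>n. A n / (real n * u n)) \<longlonglongrightarrow> s\<^sup>2" by (simp add: suminf_diff_sq)
  have B: "(\<lambda>n. B n / (real n * u n)) \<longlonglongrightarrow> 0"
  proof (rule Lim_null_comparison)
    show "(\<lambda>n. 4 * C * ((\<Sum>k\<le>n. real k * u k) / real n)) \<longlonglongrightarrow> 0"
      using tendsto_mult[OF tendsto_const average_weighted_tendsto_0[OF sum u_nonneg], of "4 * C"] by simp
    show "\<forall>\<^sub>F n in sequentially. norm (B n / (real n * u n)) \<le> 4 * C * ((\<Sum>k\<le>n. real k * u k) / real n)"
      using cmp upos eventually_gt_at_top[of 0]
    proof eventually_elim
      case (elim n)
      have nu: "real n * u n > 0" using elim by simp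
      have "\<bar>B n\<bar> \<le> (\<Sum>j | n < 2 * j \<and> j \<le> n. \<bar>diff_sq j * (real (n - j) * u (n - j))\<bar>)" unfolding B_def by (rule sum_abs)
      also have "\<dots> \<le> (\<Sum>j | n < 2 * j \<and> j \<le> n. (4 * C * u n) * (real (n - j) * u (n - j)))"
      proof (rule sum_mono)
        fix j assume "j \<in> {j. n < 2 * j \<and> j \<le> n}"
        then have "u j \<le> C * u n" using elim(1) by auto
        then have gj: "\<bar>diff_sq j\<bar> \<le> 4 * C * u n" using abs_diff_sq_le[of j] by linarith
        have nn: "0 \<le> real (n - j) * u (n - j)" using u_nonneg by simp
        show "\<bar>diff_sq j * (real (n - j) * u (n - j))\<bar> \<le> (4 * C * u n) * (real (n - j) * u (n - j))"
          unfolding abs_mult[of "diff_sq j"] abs_of_nonneg[OF nn] by (rule mult_right_mono[OF gj nn])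
      qed
      also have "\<dots> \<le> (\<Sum>j\<le>n. (4 * C * u n) * (real (n - j) * u (n - j)))"
        using C elim u_nonneg by (intro sum_mono2) auto
      also have "\<dots> = (4 * C * u n) * (\<Sum>k\<le>n. real k * u k)"
        unfolding sum_distrib_left[symmetric] by (subst sum.nat_diff_reindex[where n = "Suc n" and g = "\<lambda>k. real k * u k", simplified lessThan_Suc_atMost, symmetric]) simp
      finally have "\<bar>B n\<bar> / (real n * u n) \<le> ((4 * C * u n) * (\<Sum>k\<le>n. real k * u k)) / (real n * u n)"
        using nu by (intro divide_right_mono) auto
      also have "\<dots> = 4 * C * ((\<Sum>k\<le>n. real k * u k) / real n)" using elim by simp
      finally show ?case unfolding real_norm_def abs_divide abs_of_pos[OF nu] .
    qed
  qed
  have "(\<lambda>n. (A n / (real n * u n) + B n / (real n * u n)) / (r n)\<^sup>2) \<longlonglongrightarrow> (s\<^sup>2 + 0) / s\<^sup>2"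
    using s by (intro tendsto_divide tendsto_add A B tendsto_power) auto
  moreover have "\<forall>\<^sub>F n in sequentially. (A n / (real n * u n) + B n / (real n * u n)) / (r n)\<^sup>2 = f n / ((r n)\<^sup>2 * u n)"
    using eventually_gt_at_top[of 0]
    by eventually_elim (simp add: AB[symmetric] mult_ac flip: add_divide_distrib)
  ultimately have "(\<lambda>n. f n / ((r n)\<^sup>2 * u n)) \<longlonglongrightarrow> (s\<^sup>2 + 0) / s\<^sup>2"
    by (rule Lim_transform_eventually)
  then show ?thesis using s(2) by (intro asymp_equivI') simp
qed

text \<open>
The index is at most -1 because the partial sums of u vary slowly.  At -1 only window averages of f are
controlled; below -1 the equivalence holds termwise, and window averages inherit it.
\<close>

theorem window_equiv_increments:
  assumes u: "regularly_varying u" and U: "slowly_varying (\<lambda>n. \<Sum>k\<le>n. u k)"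
  shows "window_equiv f (\<lambda>n. (r n)\<^sup>2 * u n)" "\<exists>\<rho>. regularly_varying_index (\<lambda>n. (r n)\<^sup>2 * u n) \<rho>"
proof -
  obtain \<rho> where \<rho>: "regularly_varying_index u \<rho>" using u by (auto simp: regularly_varying_def)
  have r: "regularly_varying_index r 0" using tail_slowly_varying[OF U] by (simp add: slowly_varying_def)
  have v: "regularly_varying_index (\<lambda>n. (r n)\<^sup>2 * u n) \<rho>"
    using regularly_varying_index_mult[OF regularly_varying_index_mult[OF r r] \<rho>]
    by (simp add: power2_eq_square)
  then show "\<exists>\<rho>. regularly_varying_index (\<lambda>n. (r n)\<^sup>2 * u n) \<rho>" ..
  consider "\<rho> = -1" | "\<rho> < -1" using index_le_minus_1[OF \<rho> U] by linarith
  then show "window_equiv f (\<lambda>n. (r n)\<^sup>2 * u n)"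
  proof cases
    case 1
    with \<rho> U show ?thesis by (intro window_equiv_index_minus_1) auto
  next
    case 2
    show ?thesis
      by (rule window_equiv_of_asymp_equiv[OF v asymp_equiv_of_summable[OF \<rho> summable_of_index_less[OF \<rho> 2]]])
  qed
qed

end

section \<open>Renewal processes\<close>

lemma measurable_add_enat:
  assumes "f \<in> measurable N (count_space UNIV)" "g \<in> measurable N (count_space UNIV)"
  shows "(\<lambda>x. f x + g x :: enat) \<in> measurable N (count_space UNIV)"
  by (rule measurable_compose_countable[where f = "\<lambda>i x. i + g x" and g = f, OF _ assms(1)])
     (rule measurable_compose[OF assms(2)], simp)

lemma measurable_sum_enat:
  fixes k :: nat
  assumes "\<And>i. i < k \<Longrightarrow> h i \<in> measurable N (count_space UNIV)"
  shows "(\<lambda>x. \<Sum>i<k. h i x :: enat) \<in> measurable N (count_space UNIV)"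
  using assms by (induction k) (auto intro!: measurable_add_enat)

context renewal_process
begin

lemma measurable_increment [measurable]: "X i \<in> measurable M (count_space UNIV)"
  using indep_increments by (simp add: indep_vars_def)

lemma measurable_renewal_time [measurable]: "renewal_time X k \<in> measurable M (count_space UNIV)"
  unfolding renewal_time_def[abs_def] by (rule measurable_sum_enat) measurable

lemma renewal_time_Suc: "renewal_time X (Suc k) \<omega> = renewal_time X k \<omega> + X k \<omega>"
  by (simp add: renewal_time_def)

lemma renewal_time_ge: "\<omega> \<in> space M \<Longrightarrow> renewal_time X k \<omega> \<ge> enat k"
proof (induction k)
  case (Suc k)
  have "enat (Suc k) = enat k + 1" by (simp add: one_enat_def)
  also have "\<dots> \<le> renewal_time X k \<omega> + X k \<omega>" using Suc increments_ge_1 by (intro add_mono) auto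
  finally show ?case by (simp add: renewal_time_Suc)
qed (simp add: zero_enat_def[symmetric])

lemma renewal_time_mono: "k \<le> l \<Longrightarrow> renewal_time X k \<omega> \<le> renewal_time X l \<omega>"
  unfolding renewal_time_def by (intro sum_mono2) auto

lemma renewal_time_inj:
  assumes "\<omega> \<in> space M" "renewal_time X k \<omega> = enat n" "renewal_time X l \<omega> = enat n"
  shows "k = l"
proof -
  have "\<not> k < l" if "renewal_time X k \<omega> = enat n" "renewal_time X l \<omega> = enat n" for k l
  proof
    assume "k < l"
    then have "renewal_time X (Suc k) \<omega> \<le> renewal_time X l \<omega>" by (intro renewal_time_mono) simp
    then have "enat n + X k \<omega> \<le> enat n" using that by (simp add: renewal_time_Suc)
    moreover have "enat n + 1 \<le> enat n + X k \<omega>" using increments_ge_1[OF assms(1)] by (intro add_left_mono)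
    ultimately have "enat n + 1 \<le> enat n" by (rule order_trans[rotated])
    then show False by (simp add: one_enat_def)
  qed
  from this[OF assms(2,3)] this[OF assms(3,2)] show ?thesis by simp
qed

definition increment_prob :: "nat \<Rightarrow> real" where
  "increment_prob n = \<P>(\<omega> in M. renewal_time X 1 \<omega> = enat n)"
definition tail_prob :: "nat \<Rightarrow> real" where
  "tail_prob n = \<P>(\<omega> in M. renewal_time X 1 \<omega> > enat n)"
definition renewal_prob :: "nat \<Rightarrow> real" where
  "renewal_prob n = \<P>(\<omega> in M. n \<in> renewal_set X \<omega>)"

lemma renewal_time_1: "renewal_time X 1 = X 0"
  by (simp add: renewal_time_def fun_eq_iff)

lemma prob_increment: "\<P>(\<omega> in M. X i \<omega> = enat n) = increment_prob n"
proof -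
  have *: "\<P>(\<omega> in M. X j \<omega> = enat n) = measure (distr M (count_space UNIV) (X j)) {enat n}" for j
    by (subst measure_distr) (auto intro!: arg_cong[where f = prob])
  show ?thesis unfolding increment_prob_def renewal_time_1 * identically_distributed[of i] ..
qed

text \<open>
Decomposition according to the value of the k-th renewal time, which is independent of the next increment.
\<close>

lemma prob_renewal_time_Suc:
  "\<P>(\<omega> in M. renewal_time X (Suc k) \<omega> = enat n)
     = (\<Sum>j\<le>n. \<P>(\<omega> in M. renewal_time X k \<omega> = enat j) * increment_prob (n - j))"
proof -
  let ?C = "\<lambda>_::nat. count_space (UNIV :: enat set)"
  have "indep_var (PiM {..<k} ?C) (\<lambda>\<omega>. restrict (\<lambda>i. X i \<omega>) {..<k}) (PiM {k} ?C) (\<lambda>\<omega>. restrict (\<lambda>i. X i \<omega>) {k})"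
    by (rule indep_var_restrict[OF indep_increments]) auto
  moreover have "(\<lambda>x. \<Sum>i<k. x i) \<in> measurable (PiM {..<k} ?C) (count_space UNIV)"
    by (rule measurable_sum_enat) measurable
  moreover have "(\<lambda>x. x k) \<in> measurable (PiM {k} ?C) (count_space UNIV)" by measurable
  ultimately have "indep_var (count_space UNIV) ((\<lambda>x. \<Sum>i<k. x i) \<circ> (\<lambda>\<omega>. restrict (\<lambda>i. X i \<omega>) {..<k}))
      (count_space UNIV) ((\<lambda>x. x k) \<circ> (\<lambda>\<omega>. restrict (\<lambda>i. X i \<omega>) {k}))"
    by (rule indep_var_compose)
  then have ind: "indep_var (count_space UNIV) (renewal_time X k) (count_space UNIV) (X k)"
    by (simp add: o_def renewal_time_def[abs_def])
  have "\<P>(\<omega> in M. renewal_time X (Suc k) \<omega> = enat n)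
      = prob (\<Union>j\<in>{..n}. {\<omega> \<in> space M. renewal_time X k \<omega> = enat j \<and> X k \<omega> = enat (n - j)})"
  proof (rule arg_cong[where f = prob], intro set_eqI iffI)
    fix \<omega> assume "\<omega> \<in> {\<omega> \<in> space M. renewal_time X (Suc k) \<omega> = enat n}"
    then have \<omega>: "\<omega> \<in> space M" and eq: "renewal_time X k \<omega> + X k \<omega> = enat n" by (auto simp: renewal_time_Suc)
    obtain i j where ij: "renewal_time X k \<omega> = enat i" "X k \<omega> = enat j"
      using eq by (cases "renewal_time X k \<omega>"; cases "X k \<omega>") auto
    with eq have "i + j = n" by simp
    then have "i \<le> n" "j = n - i" by auto
    with \<omega> ij show "\<omega> \<in> (\<Union>j\<in>{..n}. {\<omega> \<in> space M. renewal_time X k \<omega> = enat j \<and> X k \<omega> = enat (n - j)})" by auto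
  qed (auto simp: renewal_time_Suc)
  also have "\<dots> = (\<Sum>j\<le>n. \<P>(\<omega> in M. renewal_time X k \<omega> = enat j \<and> X k \<omega> = enat (n - j)))"
    by (rule finite_measure_finite_Union) (auto simp: disjoint_family_on_def)
  also have "\<dots> = (\<Sum>j\<le>n. \<P>(\<omega> in M. renewal_time X k \<omega> = enat j) * increment_prob (n - j))"
  proof (rule sum.cong[OF refl])
    fix j
    have "prob ((\<lambda>\<omega>. (renewal_time X k \<omega>, X k \<omega>)) -` ({enat j} \<times> {enat (n - j)}) \<inter> space M)
        = prob (renewal_time X k -` {enat j} \<inter> space M) * prob (X k -` {enat (n - j)} \<inter> space M)"
      by (rule indep_varD[OF ind]) auto
    also have "(\<lambda>\<omega>. (renewal_time X k \<omega>, X k \<omega>)) -` ({enat j} \<times> {enat (n - j)}) \<inter> space M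
        = {\<omega> \<in> space M. renewal_time X k \<omega> = enat j \<and> X k \<omega> = enat (n - j)}" by auto
    also have "renewal_time X k -` {enat j} \<inter> space M = {\<omega> \<in> space M. renewal_time X k \<omega> = enat j}" by auto
    also have "X k -` {enat (n - j)} \<inter> space M = {\<omega> \<in> space M. X k \<omega> = enat (n - j)}" by auto
    finally show "\<P>(\<omega> in M. renewal_time X k \<omega> = enat j \<and> X k \<omega> = enat (n - j))
        = \<P>(\<omega> in M. renewal_time X k \<omega> = enat j) * increment_prob (n - j)"
      by (simp add: prob_increment)
  qed
  finally show ?thesis .
qed

lemma renewal_prob_eq_sum:
  assumes "n \<le> m"
  shows "renewal_prob n = (\<Sum>k\<le>m. \<P>(\<omega> in M. renewal_time X k \<omega> = enat n))"
proof -
  have "renewal_prob n = prob (\<Union>k\<in>{..m}. {\<omega> \<in> space M. renewal_time X k \<omega> = enat n})"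
    unfolding renewal_prob_def
  proof (rule arg_cong[where f = prob], intro set_eqI iffI)
    fix \<omega> assume "\<omega> \<in> {\<omega> \<in> space M. n \<in> renewal_set X \<omega>}"
    then obtain k where k: "\<omega> \<in> space M" "renewal_time X k \<omega> = enat n" by (auto simp: renewal_set_def)
    with renewal_time_ge[OF k(1), of k] have "k \<le> m" using assms by simp
    with k show "\<omega> \<in> (\<Union>k\<in>{..m}. {\<omega> \<in> space M. renewal_time X k \<omega> = enat n})" by auto
  qed (auto simp: renewal_set_def)
  also have "\<dots> = (\<Sum>k\<le>m. \<P>(\<omega> in M. renewal_time X k \<omega> = enat n))"
    by (rule finite_measure_finite_Union) (auto simp: disjoint_family_on_def dest: renewal_time_inj)
  finally show ?thesis .
qed

text \<open>
Sum the recursion for the renewal times over k.  Conditioning on the last increment before n avoids any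
shift of the process.
\<close>

lemma renewal_equation:
  "renewal_prob n = of_bool (n = 0) + (\<Sum>j\<le>n. renewal_prob j * increment_prob (n - j))"
proof -
  have "renewal_prob n = (\<Sum>k\<le>Suc n. \<P>(\<omega> in M. renewal_time X k \<omega> = enat n))"
    by (rule renewal_prob_eq_sum) simp
  also have "\<dots> = \<P>(\<omega> in M. renewal_time X 0 \<omega> = enat n)
      + (\<Sum>k\<le>n. \<Sum>j\<le>n. \<P>(\<omega> in M. renewal_time X k \<omega> = enat j) * increment_prob (n - j))"
    by (subst sum.atMost_Suc_shift) (simp only: prob_renewal_time_Suc)
  also have "\<P>(\<omega> in M. renewal_time X 0 \<omega> = enat n) = of_bool (n = 0)"
    using prob_space by (auto simp: renewal_time_def zero_enat_def)
  also have "(\<Sum>k\<le>n. \<Sum>j\<le>n. \<P>(\<omega> in M. renewal_time X k \<omega> = enat j) * increment_prob (n - j))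
      = (\<Sum>j\<le>n. renewal_prob j * increment_prob (n - j))"
    by (subst sum.swap) (intro sum.cong refl, simp add: renewal_prob_eq_sum flip: sum_distrib_right)
  finally show ?thesis .
qed

lemma tail_prob_eq: "tail_prob n = 1 - (\<Sum>k\<le>n. increment_prob k)"
proof -
  have "{\<omega> \<in> space M. renewal_time X 1 \<omega> > enat n} = space M - (\<Union>k\<in>{..n}. {\<omega> \<in> space M. renewal_time X 1 \<omega> = enat k})"
  proof (intro set_eqI iffI)
    fix \<omega> assume "\<omega> \<in> space M - (\<Union>k\<in>{..n}. {\<omega> \<in> space M. renewal_time X 1 \<omega> = enat k})"
    then show "\<omega> \<in> {\<omega> \<in> space M. renewal_time X 1 \<omega> > enat n}"
      by (cases "renewal_time X 1 \<omega>") (auto simp: not_le)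
  qed auto
  then have "tail_prob n = 1 - prob (\<Union>k\<in>{..n}. {\<omega> \<in> space M. renewal_time X 1 \<omega> = enat k})"
    unfolding tail_prob_def by (simp only:) (rule prob_compl, measurable)
  also have "prob (\<Union>k\<in>{..n}. {\<omega> \<in> space M. renewal_time X 1 \<omega> = enat k}) = (\<Sum>k\<le>n. increment_prob k)"
    unfolding increment_prob_def by (rule finite_measure_finite_Union) (auto simp: disjoint_family_on_def)
  finally show ?thesis .
qed

sublocale renewal_sequence increment_prob renewal_prob tail_prob
proof
  show "increment_prob 0 = 0"
  proof -
    have "{\<omega> \<in> space M. renewal_time X 1 \<omega> = enat 0} = {}"
      using renewal_time_ge[of _ 1] by force
    then show ?thesis by (simp only: increment_prob_def measure_empty)
  qed
qed (simp_all add: tail_prob_eq[symmetric] renewal_equation[symmetric], simp_all add: increment_prob_def tail_prob_def)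

end

theorem theorem1p3:
  fixes M :: "'a measure" and X :: "nat \<Rightarrow> 'a \<Rightarrow> enat"
  assumes "renewal_process M X"
    and "regularly_varying (\<lambda>n. \<P>(\<omega> in M. n \<in> renewal_set X \<omega>))"
    and "slowly_varying (\<lambda>n. \<Sum>k=0..n. \<P>(\<omega> in M. k \<in> renewal_set X \<omega>))"
  shows "(\<exists>\<epsilon> :: nat \<Rightarrow> real. (\<forall>n. \<epsilon> n > 0) \<and> \<epsilon> \<longlonglongrightarrow> 0 \<and>
            (\<lambda>n. 1 / (\<epsilon> n * real n) *
                 (\<Sum>k | (1 - \<epsilon> n) * real n < real k \<and> k \<le> n.
                    \<P>(\<omega> in M. renewal_time X 1 \<omega> = enat k)))
              \<sim>[sequentially]
            (\<lambda>n. \<P>(\<omega> in M. renewal_time X 1 \<omega> > enat n) ^ 2 *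
                 \<P>(\<omega> in M. n \<in> renewal_set X \<omega>))) \<and>
         (regularly_varying (\<lambda>n. \<P>(\<omega> in M. renewal_time X 1 \<omega> = enat n)) \<longrightarrow>
            (\<lambda>n. \<P>(\<omega> in M. renewal_time X 1 \<omega> = enat n))
              \<sim>[sequentially]
            (\<lambda>n. \<P>(\<omega> in M. renewal_time X 1 \<omega> > enat n) ^ 2 *
                 \<P>(\<omega> in M. n \<in> renewal_set X \<omega>)))"
proof -
  interpret renewal_process M X by fact
  let ?v = "\<lambda>n. (tail_prob n)\<^sup>2 * renewal_prob n"
  have u: "regularly_varying renewal_prob" and U: "slowly_varying (\<lambda>n. \<Sum>k\<le>n. renewal_prob k)"
    using assms(2,3) by (simp_all add: renewal_prob_def[abs_def] atMost_atLeast0)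
  have win: "window_equiv increment_prob ?v" by (rule window_equiv_increments(1)[OF u U])
  have v: "\<forall>\<^sub>F n in sequentially. ?v n > 0"
    using window_equiv_increments(2)[OF u U] by (auto simp: regularly_varying_index_def)
  obtain \<epsilon> where \<epsilon>: "\<And>n. \<epsilon> n > 0" "\<epsilon> \<longlonglongrightarrow> 0"
    "(\<lambda>n. window_average increment_prob (\<epsilon> n) n) \<sim>[sequentially] ?v"
    by (rule window_equiv_diagonal[OF win v]) blast
  have "increment_prob \<sim>[sequentially] ?v" if "regularly_varying increment_prob"
  proof -
    obtain \<sigma> where "regularly_varying_index increment_prob \<sigma>"
      using \<open>regularly_varying increment_prob\<close> by (auto simp: regularly_varying_def)
    then have "window_equiv increment_prob increment_prob" "\<forall>\<^sub>F n in sequentially. increment_prob n > 0"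
      by (auto simp: window_equiv_refl regularly_varying_index_def)
    then show ?thesis by (rule window_equiv_unique[OF _ _ win v])
  qed
  then show ?thesis
    using \<epsilon> unfolding window_average_def increment_prob_def[abs_def] renewal_prob_def tail_prob_def
    by blast
qed

end
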